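(* The underlying-category $2$-functor $V\colon[\mathbf F,\mathbf{Set}]\text{-}\mathbf{CAT}_{\mathrm{rep}}\to\mathbf{CAT}_{\mathrm{fp}}$ is an equivalence of $2$-categories.
   Context: $\mathbf F$ is the full subcategory of $\mathbf{Set}$ on the finite cardinals; $[\mathbf F,\mathbf{Set}]$ is monoidal with unit the inclusion $\mathbf F\to\mathbf{Set}$ and tensor $(A\otimes B)(n)=\int^{m\in\mathbf F}Am\times(Bn)^m$. Categories enriched in it unfold as follows. An $[\mathbf F,\mathbf{Set}]$-category $\mathcal M$ consists of: a (possibly large) collection of objects; sets $\mathcal M_n(X,Y)$ for objects $X,Y$ and $n\in\mathbf F$, functorial in $n$ via maps $\phi_\ast\colon\mathcal M_n(X,Y)\to\mathcal M_m(X,Y)$ for $\phi\colon n\to m$; identities $1_X\in\mathcal M_1(X,X)$; and composition operations $\mathcal M_m(Y,Z)\times\mathcal M_n(X,Y)^m\to\mathcal M_n(X,Z)$, $(g,f_1,\dots,f_m)\mapsto g\circ(f_1,\dots,f_m)$, natural in $n$ and $m$. Writing $\pi_1,\dots,\pi_n\in\mathcal M_n(X,X)$ for the images of $1_X$ under the $n$ maps $1\to n$, the axioms are $\pi_i\circ(f_1,\dots,f_n)=f_i$; $g\circ(\pi_1,\dots,\pi_n)=g$; and $h\circ(g_1\circ(f_1,\dots,f_k),\dots,g_j\circ(f_1,\dots,f_k))=(h\circ(g_1,\dots,g_j))\circ(f_1,\dots,f_k)$. An $[\mathbf F,\mathbf{Set}]$-functor $F\colon\mathcal M\to\mathcal N$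 is an assignment on objects with maps $\mathcal M_n(X,Y)\to\mathcal N_n(FX,FY)$ natural in $n$ and preserving composition and identities. A transformation $\alpha\colon F\Rightarrow G$ consists of $\alpha_X\in\mathcal N_1(FX,GX)$ with $\alpha_Y\circ Ff=Gf\circ(\alpha_X\circ\pi_1,\dots,\alpha_X\circ\pi_n)$ for all $f\in\mathcal M_n(X,Y)$. These form a $2$-category $[\mathbf F,\mathbf{Set}]\text{-}\mathbf{CAT}$. Let $y_n=\mathbf F(n,-)$. An element $i\in\mathcal M_n(X,Z)$ exhibits $Z$ as the tensor $y_n\otimes X$ if for all $Y\in\mathcal M$ and $k\in\mathbf F$ the function $\mathcal M_k(Z,Y)\to\mathcal M_{kn}(X,Y)$, $g\mapsto g\circ((\iota_1)_\ast i,\dots,(\iota_k)_\ast i)$, is invertible, where $\iota_j\colon n\to kn=n+\dots+n$ are the coproduct injections. $\mathcal M$ is representable if the tensor $y_n\otimes X$ exists for all $X\in\mathcal M$ and $n\in\mathbf F$. $[\mathbf F,\mathbf{Set}]\text{-}\mathbf{CAT}_{\mathrm{rep}}$ is the full sub-$2$-category of $[\mathbf F,\mathbf{Set}]\text{-}\mathbf{CAT}$ on the representable objects. $\mathbf{CAT}_{\mathrm{fp}}$ is the $2$-category of categories with finite powers (an $n$-fold product $X^n$ of each object $X$ with itself, for every natural number $n$), functors preserving finite powers (up to isomorphism, in the usual sense), and natural transformations. $V\mathcal M$ is the ordinary category with the objects of $\mathcal M$ and homsets $V\mathcal M(X,Y)=\mathcal M_1(X,Y)$, with the evident action of $V$ on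 functors and transformations; if $\mathcal M$ is representable then $V\mathcal M$ has finite powers, and $V$ sends enriched functors between representables to finite-power-preserving functors. *)

theory Defs
  imports "HOL-Library.FuncSet"
begin

section \<open>Categories, functors and natural transformations\<close>

text \<open>
  A category with objects in \<open>'o\<close> and arrows in \<open>'a\<close>. Hom-sets need not be disjoint, so
  composition carries its objects: \<open>cmp C X Y Z g f\<close> is the composite of \<open>f : X \<rightarrow> Y\<close> and
  \<open>g : Y \<rightarrow> Z\<close>. The type \<open>'o\<close> bounds the possibly large collections of objects, the type
  \<open>'a\<close> bounds the hom-sets; both are arbitrary.
\<close>

record ('o, 'a) cat =
  obj :: "'o set"
  hom :: "'o \<Rightarrow> 'o \<Rightarrow> 'a set"
  idt :: "'o \<Rightarrow> 'a"
  cmp :: "'o \<Rightarrow> 'o \<Rightarrow> 'o \<Rightarrow> 'a \<Rightarrow> 'a \<Rightarrow> 'a"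

locale category =
  fixes C :: "('o, 'a) cat"
  assumes idt_in: "X \<in> obj C \<Longrightarrow> idt C X \<in> hom C X X"
    and cmp_in:
      "\<lbrakk>X \<in> obj C; Y \<in> obj C; Z \<in> obj C; g \<in> hom C Y Z; f \<in> hom C X Y\<rbrakk>
        \<Longrightarrow> cmp C X Y Z g f \<in> hom C X Z"
    and cmp_idt_left:
      "\<lbrakk>X \<in> obj C; Y \<in> obj C; f \<in> hom C X Y\<rbrakk> \<Longrightarrow> cmp C X Y Y (idt C Y) f = f"
    and cmp_idt_right:
      "\<lbrakk>X \<in> obj C; Y \<in> obj C; f \<in> hom C X Y\<rbrakk> \<Longrightarrow> cmp C X X Y f (idt C X) = f"
    and cmp_assoc:
      "\<lbrakk>W \<in> obj C; X \<in> obj C; Y \<in> obj C; Z \<in> obj C;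
        h \<in> hom C Y Z; g \<in> hom C X Y; f \<in> hom C W X\<rbrakk>
        \<Longrightarrow> cmp C W Y Z h (cmp C W X Y g f) = cmp C W X Z (cmp C X Y Z h g) f"

record ('o, 'a, 'p, 'b) cat_fun =
  fobj :: "'o \<Rightarrow> 'p"
  farr :: "'o \<Rightarrow> 'o \<Rightarrow> 'a \<Rightarrow> 'b"

locale is_functor =
  fixes C :: "('o, 'a) cat" and D :: "('p, 'b) cat" and F :: "('o, 'a, 'p, 'b) cat_fun"
  assumes fobj_in: "X \<in> obj C \<Longrightarrow> fobj F X \<in> obj D"
    and farr_in:
      "\<lbrakk>X \<in> obj C; Y \<in> obj C; f \<in> hom C X Y\<rbrakk>
        \<Longrightarrow> farr F X Y f \<in> hom D (fobj F X) (fobj F Y)"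
    and farr_idt: "X \<in> obj C \<Longrightarrow> farr F X X (idt C X) = idt D (fobj F X)"
    and farr_cmp:
      "\<lbrakk>X \<in> obj C; Y \<in> obj C; Z \<in> obj C; g \<in> hom C Y Z; f \<in> hom C X Y\<rbrakk>
        \<Longrightarrow> farr F X Z (cmp C X Y Z g f)
          = cmp D (fobj F X) (fobj F Y) (fobj F Z) (farr F Y Z g) (farr F X Y f)"

text \<open>
  Values off the domain are fixed to \<open>undefined\<close>, so that equality of functors that are
  1-cells of a 2-category is equality of functors in the mathematical sense.
\<close>

definition functor_ext :: "('o, 'a) cat \<Rightarrow> ('o, 'a, 'p, 'b) cat_fun \<Rightarrow> bool" where
  "functor_ext C F \<longleftrightarrow>
     fobj F \<in> extensional (obj C) \<and>
     (\<forall>X Y f. \<not> (X \<in> obj C \<and> Y \<in> obj C \<and> f \<in> hom C X Y) \<longrightarrow> farr F X Y f = undefined)"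

definition id_functor :: "('o, 'a) cat \<Rightarrow> ('o, 'a, 'o, 'a) cat_fun" where
  "id_functor C =
     \<lparr>fobj = (\<lambda>X\<in>obj C. X),
      farr = (\<lambda>X Y f. if X \<in> obj C \<and> Y \<in> obj C \<and> f \<in> hom C X Y then f else undefined)\<rparr>"

definition comp_functor ::
  "('o, 'a) cat \<Rightarrow> ('p, 'b, 'q, 'c) cat_fun \<Rightarrow> ('o, 'a, 'p, 'b) cat_fun
    \<Rightarrow> ('o, 'a, 'q, 'c) cat_fun" where
  "comp_functor C G F =
     \<lparr>fobj = (\<lambda>X\<in>obj C. fobj G (fobj F X)),
      farr = (\<lambda>X Y f. if X \<in> obj C \<and> Y \<in> obj C \<and> f \<in> hom C X Y
                      then farr G (fobj F X) (fobj F Y) (farr F X Y f) else undefined)\<rparr>"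

locale nat_trans =
  fixes C :: "('o, 'a) cat" and D :: "('p, 'b) cat"
    and F G :: "('o, 'a, 'p, 'b) cat_fun" and \<alpha> :: "'o \<Rightarrow> 'b"
  assumes component_in: "X \<in> obj C \<Longrightarrow> \<alpha> X \<in> hom D (fobj F X) (fobj G X)"
    and naturality:
      "\<lbrakk>X \<in> obj C; Y \<in> obj C; f \<in> hom C X Y\<rbrakk>
        \<Longrightarrow> cmp D (fobj F X) (fobj F Y) (fobj G Y) (\<alpha> Y) (farr F X Y f)
          = cmp D (fobj F X) (fobj G X) (fobj G Y) (farr G X Y f) (\<alpha> X)"

definition prod_cat :: "('o, 'a) cat \<Rightarrow> ('p, 'b) cat \<Rightarrow> ('o \<times> 'p, 'a \<times> 'b) cat" where
  "prod_cat C D =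
     \<lparr>obj = obj C \<times> obj D,
      hom = (\<lambda>X Y. hom C (fst X) (fst Y) \<times> hom D (snd X) (snd Y)),
      idt = (\<lambda>X. (idt C (fst X), idt D (snd X))),
      cmp = (\<lambda>X Y Z g f. (cmp C (fst X) (fst Y) (fst Z) (fst g) (fst f),
                          cmp D (snd X) (snd Y) (snd Z) (snd g) (snd f)))\<rparr>"

section \<open>2-categories, 2-functors and equivalences of 2-categories\<close>

text \<open>
  A (strict) 2-category is a category enriched in categories: \<open>tcomp T A B C\<close> is the
  composition functor \<open>T(B,C) \<times> T(A,B) \<rightarrow> T(A,C)\<close>, whose action on 2-cells is horizontal
  composition.
\<close>

record ('c, 'f, 't) two_cat =
  tobj :: "'c set"
  thom :: "'c \<Rightarrow> 'c \<Rightarrow> ('f, 't) cat"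
  tid :: "'c \<Rightarrow> 'f"
  tcomp :: "'c \<Rightarrow> 'c \<Rightarrow> 'c \<Rightarrow> ('f \<times> 'f, 't \<times> 't, 'f, 't) cat_fun"

definition comp1 ::
  "('c, 'f, 't) two_cat \<Rightarrow> 'c \<Rightarrow> 'c \<Rightarrow> 'c \<Rightarrow> 'f \<Rightarrow> 'f \<Rightarrow> 'f" where
  "comp1 T A B C g f = fobj (tcomp T A B C) (g, f)"

text \<open>For \<open>\<alpha> : f \<Rightarrow> f'\<close> and \<open>\<beta> : g \<Rightarrow> g'\<close>, the horizontal composite
  \<open>comp2 T A B C g g' f f' \<beta> \<alpha> : g f \<Rightarrow> g' f'\<close>.\<close>

definition comp2 ::
  "('c, 'f, 't) two_cat \<Rightarrow> 'c \<Rightarrow> 'c \<Rightarrow> 'c \<Rightarrow> 'f \<Rightarrow> 'f \<Rightarrow> 'f \<Rightarrow> 'f \<Rightarrow> 't \<Rightarrow> 't \<Rightarrow> 't" where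
  "comp2 T A B C g g' f f' \<beta> \<alpha> = farr (tcomp T A B C) (g, f) (g', f') (\<beta>, \<alpha>)"

locale two_category =
  fixes T :: "('c, 'f, 't) two_cat"
  assumes thom_category: "\<lbrakk>A \<in> tobj T; B \<in> tobj T\<rbrakk> \<Longrightarrow> category (thom T A B)"
    and tid_in: "A \<in> tobj T \<Longrightarrow> tid T A \<in> obj (thom T A A)"
    and tcomp_functor:
      "\<lbrakk>A \<in> tobj T; B \<in> tobj T; C \<in> tobj T\<rbrakk>
        \<Longrightarrow> is_functor (prod_cat (thom T B C) (thom T A B)) (thom T A C) (tcomp T A B C)"
    and comp1_tid_left:
      "\<lbrakk>A \<in> tobj T; B \<in> tobj T; f \<in> obj (thom T A B)\<rbrakk> \<Longrightarrow> comp1 T A B B (tid T B) f = f"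
    and comp1_tid_right:
      "\<lbrakk>A \<in> tobj T; B \<in> tobj T; f \<in> obj (thom T A B)\<rbrakk> \<Longrightarrow> comp1 T A A B f (tid T A) = f"
    and comp1_assoc:
      "\<lbrakk>A \<in> tobj T; B \<in> tobj T; C \<in> tobj T; D \<in> tobj T;
        h \<in> obj (thom T C D); g \<in> obj (thom T B C); f \<in> obj (thom T A B)\<rbrakk>
        \<Longrightarrow> comp1 T A C D h (comp1 T A B C g f) = comp1 T A B D (comp1 T B C D h g) f"
    and comp2_tid_left:
      "\<lbrakk>A \<in> tobj T; B \<in> tobj T; f \<in> obj (thom T A B); f' \<in> obj (thom T A B);
        \<alpha> \<in> hom (thom T A B) f f'\<rbrakk>
        \<Longrightarrow> comp2 T A B B (tid T B) (tid T B) f f' (idt (thom T B B) (tid T B)) \<alpha> = \<alpha>"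
    and comp2_tid_right:
      "\<lbrakk>A \<in> tobj T; B \<in> tobj T; f \<in> obj (thom T A B); f' \<in> obj (thom T A B);
        \<alpha> \<in> hom (thom T A B) f f'\<rbrakk>
        \<Longrightarrow> comp2 T A A B f f' (tid T A) (tid T A) \<alpha> (idt (thom T A A) (tid T A)) = \<alpha>"
    and comp2_assoc:
      "\<lbrakk>A \<in> tobj T; B \<in> tobj T; C \<in> tobj T; D \<in> tobj T;
        h \<in> obj (thom T C D); h' \<in> obj (thom T C D);
        g \<in> obj (thom T B C); g' \<in> obj (thom T B C);
        f \<in> obj (thom T A B); f' \<in> obj (thom T A B);
        \<gamma> \<in> hom (thom T C D) h h'; \<beta> \<in> hom (thom T B C) g g'; \<alpha> \<in> hom (thom T A B) f f'\<rbrakk>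
        \<Longrightarrow> comp2 T A C D h h' (comp1 T A B C g f) (comp1 T A B C g' f')
              \<gamma> (comp2 T A B C g g' f f' \<beta> \<alpha>)
          = comp2 T A B D (comp1 T B C D h g) (comp1 T B C D h' g') f f'
              (comp2 T B C D h h' g g' \<gamma> \<beta>) \<alpha>"

definition full_sub_two_cat ::
  "('c, 'f, 't) two_cat \<Rightarrow> ('c \<Rightarrow> bool) \<Rightarrow> ('c, 'f, 't) two_cat" where
  "full_sub_two_cat T P = T\<lparr>tobj := {A \<in> tobj T. P A}\<rparr>"

record ('c, 'f, 't, 'd, 'g, 's) two_fun =
  map0 :: "'c \<Rightarrow> 'd"
  maph :: "'c \<Rightarrow> 'c \<Rightarrow> ('f, 't, 'g, 's) cat_fun"

locale two_functor =
  fixes S :: "('c, 'f, 't) two_cat" and T :: "('d, 'g, 's) two_cat"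
    and P :: "('c, 'f, 't, 'd, 'g, 's) two_fun"
  assumes map0_in: "A \<in> tobj S \<Longrightarrow> map0 P A \<in> tobj T"
    and maph_functor:
      "\<lbrakk>A \<in> tobj S; B \<in> tobj S\<rbrakk>
        \<Longrightarrow> is_functor (thom S A B) (thom T (map0 P A) (map0 P B)) (maph P A B)"
    and maph_tid: "A \<in> tobj S \<Longrightarrow> fobj (maph P A A) (tid S A) = tid T (map0 P A)"
    and maph_comp1:
      "\<lbrakk>A \<in> tobj S; B \<in> tobj S; C \<in> tobj S; g \<in> obj (thom S B C); f \<in> obj (thom S A B)\<rbrakk>
        \<Longrightarrow> fobj (maph P A C) (comp1 S A B C g f)
          = comp1 T (map0 P A) (map0 P B) (map0 P C) (fobj (maph P B C) g) (fobj (maph P A B) f)"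
    and maph_comp2:
      "\<lbrakk>A \<in> tobj S; B \<in> tobj S; C \<in> tobj S;
        g \<in> obj (thom S B C); g' \<in> obj (thom S B C);
        f \<in> obj (thom S A B); f' \<in> obj (thom S A B);
        \<beta> \<in> hom (thom S B C) g g'; \<alpha> \<in> hom (thom S A B) f f'\<rbrakk>
        \<Longrightarrow> farr (maph P A C) (comp1 S A B C g f) (comp1 S A B C g' f')
              (comp2 S A B C g g' f f' \<beta> \<alpha>)
          = comp2 T (map0 P A) (map0 P B) (map0 P C)
              (fobj (maph P B C) g) (fobj (maph P B C) g')
              (fobj (maph P A B) f) (fobj (maph P A B) f')
              (farr (maph P B C) g g' \<beta>) (farr (maph P A B) f f' \<alpha>)"

definition id_two_fun :: "('c, 'f, 't, 'c, 'f, 't) two_fun" where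
  "id_two_fun =
     \<lparr>map0 = (\<lambda>A. A), maph = (\<lambda>A B. \<lparr>fobj = (\<lambda>f. f), farr = (\<lambda>f g \<alpha>. \<alpha>)\<rparr>)\<rparr>"

definition comp_two_fun ::
  "('d, 'g, 's, 'e, 'h, 'u) two_fun \<Rightarrow> ('c, 'f, 't, 'd, 'g, 's) two_fun
    \<Rightarrow> ('c, 'f, 't, 'e, 'h, 'u) two_fun" where
  "comp_two_fun Q P =
     \<lparr>map0 = (\<lambda>A. map0 Q (map0 P A)),
      maph = (\<lambda>A B.
        \<lparr>fobj = (\<lambda>f. fobj (maph Q (map0 P A) (map0 P B)) (fobj (maph P A B) f)),
         farr = (\<lambda>f g \<alpha>. farr (maph Q (map0 P A) (map0 P B))
                   (fobj (maph P A B) f) (fobj (maph P A B) g) (farr (maph P A B) f g \<alpha>))\<rparr>)\<rparr>"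

locale two_nat_trans =
  fixes S :: "('c, 'f, 't) two_cat" and T :: "('d, 'g, 's) two_cat"
    and P Q :: "('c, 'f, 't, 'd, 'g, 's) two_fun" and \<theta> :: "'c \<Rightarrow> 'g"
  assumes component_in: "A \<in> tobj S \<Longrightarrow> \<theta> A \<in> obj (thom T (map0 P A) (map0 Q A))"
    and naturality1:
      "\<lbrakk>A \<in> tobj S; B \<in> tobj S; f \<in> obj (thom S A B)\<rbrakk>
        \<Longrightarrow> comp1 T (map0 P A) (map0 P B) (map0 Q B) (\<theta> B) (fobj (maph P A B) f)
          = comp1 T (map0 P A) (map0 Q A) (map0 Q B) (fobj (maph Q A B) f) (\<theta> A)"
    and naturality2:
      "\<lbrakk>A \<in> tobj S; B \<in> tobj S; f \<in> obj (thom S A B); f' \<in> obj (thom S A B);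
        \<alpha> \<in> hom (thom S A B) f f'\<rbrakk>
        \<Longrightarrow> comp2 T (map0 P A) (map0 P B) (map0 Q B)
              (\<theta> B) (\<theta> B) (fobj (maph P A B) f) (fobj (maph P A B) f')
              (idt (thom T (map0 P B) (map0 Q B)) (\<theta> B)) (farr (maph P A B) f f' \<alpha>)
          = comp2 T (map0 P A) (map0 Q A) (map0 Q B)
              (fobj (maph Q A B) f) (fobj (maph Q A B) f') (\<theta> A) (\<theta> A)
              (farr (maph Q A B) f f' \<alpha>) (idt (thom T (map0 P A) (map0 Q A)) (\<theta> A))"

definition iso1 :: "('c, 'f, 't) two_cat \<Rightarrow> 'c \<Rightarrow> 'c \<Rightarrow> 'f \<Rightarrow> bool" where
  "iso1 T A B f \<longleftrightarrow>
     f \<in> obj (thom T A B) \<and>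
     (\<exists>g \<in> obj (thom T B A). comp1 T A B A g f = tid T A \<and> comp1 T B A B f g = tid T B)"

definition two_nat_iso ::
  "('c, 'f, 't) two_cat \<Rightarrow> ('d, 'g, 's) two_cat \<Rightarrow> ('c, 'f, 't, 'd, 'g, 's) two_fun
    \<Rightarrow> ('c, 'f, 't, 'd, 'g, 's) two_fun \<Rightarrow> ('c \<Rightarrow> 'g) \<Rightarrow> bool" where
  "two_nat_iso S T P Q \<theta> \<longleftrightarrow>
     two_nat_trans S T P Q \<theta> \<and> (\<forall>A \<in> tobj S. iso1 T (map0 P A) (map0 Q A) (\<theta> A))"

text \<open>
  Equivalence of 2-categories in the strict sense of category theory enriched in categories:
  the unit and counit are 2-natural isomorphisms. This is stronger than a biequivalence.
\<close>

definition two_equivalence ::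
  "('c, 'f, 't) two_cat \<Rightarrow> ('d, 'g, 's) two_cat \<Rightarrow> ('c, 'f, 't, 'd, 'g, 's) two_fun \<Rightarrow> bool"
  where
  "two_equivalence S T P \<longleftrightarrow>
     two_category S \<and> two_category T \<and> two_functor S T P \<and>
     (\<exists>(Q :: ('d, 'g, 's, 'c, 'f, 't) two_fun) \<eta> \<epsilon>.
        two_functor T S Q \<and>
        two_nat_iso S S id_two_fun (comp_two_fun Q P) \<eta> \<and>
        two_nat_iso T T (comp_two_fun P Q) id_two_fun \<epsilon>)"

section \<open>Categories with finite powers\<close>

definition is_power ::
  "('o, 'a) cat \<Rightarrow> nat \<Rightarrow> 'o \<Rightarrow> 'o \<Rightarrow> (nat \<Rightarrow> 'a) \<Rightarrow> bool" where
  "is_power C n X P p \<longleftrightarrow>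
     P \<in> obj C \<and> (\<forall>i<n. p i \<in> hom C P X) \<and>
     (\<forall>Y \<in> obj C. \<forall>f. (\<forall>i<n. f i \<in> hom C Y X) \<longrightarrow>
        (\<exists>!h. h \<in> hom C Y P \<and> (\<forall>i<n. cmp C Y P X (p i) h = f i)))"

definition has_finite_powers :: "('o, 'a) cat \<Rightarrow> bool" where
  "has_finite_powers C \<longleftrightarrow> (\<forall>X \<in> obj C. \<forall>n. \<exists>P p. is_power C n X P p)"

definition preserves_finite_powers ::
  "('o, 'a) cat \<Rightarrow> ('p, 'b) cat \<Rightarrow> ('o, 'a, 'p, 'b) cat_fun \<Rightarrow> bool" where
  "preserves_finite_powers C D F \<longleftrightarrow>
     (\<forall>X \<in> obj C. \<forall>n P p. is_power C n X P p \<longrightarrow>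
        is_power D n (fobj F X) (fobj F P) (\<lambda>i. farr F P X (p i)))"

definition fp_hom ::
  "('o, 'a) cat \<Rightarrow> ('p, 'b) cat \<Rightarrow> (('o, 'a, 'p, 'b) cat_fun, 'o \<Rightarrow> 'b) cat" where
  "fp_hom C D =
     \<lparr>obj = {F. is_functor C D F \<and> functor_ext C F \<and> preserves_finite_powers C D F},
      hom = (\<lambda>F G. {\<alpha> \<in> extensional (obj C). nat_trans C D F G \<alpha>}),
      idt = (\<lambda>F. \<lambda>X\<in>obj C. idt D (fobj F X)),
      cmp = (\<lambda>F G H \<beta> \<alpha>. \<lambda>X\<in>obj C. cmp D (fobj F X) (fobj G X) (fobj H X) (\<beta> X) (\<alpha> X))\<rparr>"

text \<open>The horizontal composite of \<open>\<alpha> : F \<Rightarrow> F'\<close> and \<open>\<beta> : G \<Rightarrow> G'\<close> has components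
  \<open>\<beta>\<^bsub>F'X\<^esub> \<circ> G \<alpha>\<^bsub>X\<^esub>\<close>.\<close>

definition CAT_fp ::
  "(('o, 'a) cat, ('o, 'a, 'o, 'a) cat_fun, 'o \<Rightarrow> 'a) two_cat" where
  "CAT_fp =
     \<lparr>tobj = {C. category C \<and> has_finite_powers C},
      thom = fp_hom,
      tid = id_functor,
      tcomp = (\<lambda>C D E.
        \<lparr>fobj = (\<lambda>(G, F). comp_functor C G F),
         farr = (\<lambda>(G, F) (G', F') (\<beta>, \<alpha>). \<lambda>X\<in>obj C.
           cmp E (fobj G (fobj F X)) (fobj G (fobj F' X)) (fobj G' (fobj F' X))
             (\<beta> (fobj F' X)) (farr G (fobj F X) (fobj F' X) (\<alpha> X)))\<rparr>)\<rparr>"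

section \<open>Categories enriched in \<open>[F, Set]\<close>\<close>

text \<open>
  The cardinal \<open>n\<close> is \<open>{..<n}\<close>, so all indices start at 0, and a map \<open>n \<rightarrow> m\<close> is an
  extensional function \<open>{..<n} \<rightarrow> {..<m}\<close>. An \<open>m\<close>-tuple is an extensional function on
  \<open>{..<m}\<close>.

  In the record below, \<open>ehom M n X Y\<close> is the set \<open>M\<^sub>n(X,Y)\<close>; \<open>push M n m X Y \<phi>\<close> is the action
  \<open>M\<^sub>n(X,Y) \<rightarrow> M\<^sub>m(X,Y)\<close> of \<open>\<phi> : n \<rightarrow> m\<close>; and \<open>ecomp M m n X Y Z g fs\<close> is the composite in
  \<open>M\<^sub>n(X,Z)\<close> of \<open>g\<close> in \<open>M\<^sub>m(Y,Z)\<close> with the \<open>m\<close>-tuple \<open>fs\<close> of elements of \<open>M\<^sub>n(X,Y)\<close>.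
\<close>

abbreviation Fmap :: "nat \<Rightarrow> nat \<Rightarrow> (nat \<Rightarrow> nat) set" where
  "Fmap n m \<equiv> {..<n} \<rightarrow>\<^sub>E {..<m}"

definition single :: "'b \<Rightarrow> nat \<Rightarrow> 'b" where
  "single x = (\<lambda>_\<in>{..<1}. x)"

record ('o, 'a) fset_cat =
  eobj :: "'o set"
  ehom :: "nat \<Rightarrow> 'o \<Rightarrow> 'o \<Rightarrow> 'a set"
  push :: "nat \<Rightarrow> nat \<Rightarrow> 'o \<Rightarrow> 'o \<Rightarrow> (nat \<Rightarrow> nat) \<Rightarrow> 'a \<Rightarrow> 'a"
  eid :: "'o \<Rightarrow> 'a"
  ecomp :: "nat \<Rightarrow> nat \<Rightarrow> 'o \<Rightarrow> 'o \<Rightarrow> 'o \<Rightarrow> 'a \<Rightarrow> (nat \<Rightarrow> 'a) \<Rightarrow> 'a"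

definition eproj :: "('o, 'a) fset_cat \<Rightarrow> nat \<Rightarrow> 'o \<Rightarrow> nat \<Rightarrow> 'a" where
  "eproj M n X i = push M 1 n X X (single i) (eid M X)"

locale fset_category =
  fixes M :: "('o, 'a) fset_cat"
  assumes push_in:
      "\<lbrakk>X \<in> eobj M; Y \<in> eobj M; \<phi> \<in> Fmap n m; f \<in> ehom M n X Y\<rbrakk>
        \<Longrightarrow> push M n m X Y \<phi> f \<in> ehom M m X Y"
    and push_id:
      "\<lbrakk>X \<in> eobj M; Y \<in> eobj M; f \<in> ehom M n X Y\<rbrakk> \<Longrightarrow> push M n n X Y (\<lambda>i\<in>{..<n}. i) f = f"
    and push_compose:
      "\<lbrakk>X \<in> eobj M; Y \<in> eobj M; \<phi> \<in> Fmap n m; \<psi> \<in> Fmap m k; f \<in> ehom M n X Y\<rbrakk>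
        \<Longrightarrow> push M n k X Y (compose {..<n} \<psi> \<phi>) f = push M m k X Y \<psi> (push M n m X Y \<phi> f)"
    and eid_in: "X \<in> eobj M \<Longrightarrow> eid M X \<in> ehom M 1 X X"
    and ecomp_in:
      "\<lbrakk>X \<in> eobj M; Y \<in> eobj M; Z \<in> eobj M; g \<in> ehom M m Y Z; fs \<in> {..<m} \<rightarrow>\<^sub>E ehom M n X Y\<rbrakk>
        \<Longrightarrow> ecomp M m n X Y Z g fs \<in> ehom M n X Z"
    and ecomp_natural_inner:
      "\<lbrakk>X \<in> eobj M; Y \<in> eobj M; Z \<in> eobj M; \<phi> \<in> Fmap n n';
        g \<in> ehom M m Y Z; fs \<in> {..<m} \<rightarrow>\<^sub>E ehom M n X Y\<rbrakk>
        \<Longrightarrow> push M n n' X Z \<phi> (ecomp M m n X Y Z g fs)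
          = ecomp M m n' X Y Z g (\<lambda>i\<in>{..<m}. push M n n' X Y \<phi> (fs i))"
    and ecomp_natural_outer:
      "\<lbrakk>X \<in> eobj M; Y \<in> eobj M; Z \<in> eobj M; \<phi> \<in> Fmap m m';
        g \<in> ehom M m Y Z; fs \<in> {..<m'} \<rightarrow>\<^sub>E ehom M n X Y\<rbrakk>
        \<Longrightarrow> ecomp M m' n X Y Z (push M m m' Y Z \<phi> g) fs
          = ecomp M m n X Y Z g (\<lambda>i\<in>{..<m}. fs (\<phi> i))"
    and proj_ecomp:
      "\<lbrakk>X \<in> eobj M; Y \<in> eobj M; fs \<in> {..<n} \<rightarrow>\<^sub>E ehom M k X Y; i < n\<rbrakk>
        \<Longrightarrow> ecomp M n k X Y Y (eproj M n Y i) fs = fs i"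
    and ecomp_proj:
      "\<lbrakk>X \<in> eobj M; Y \<in> eobj M; g \<in> ehom M n X Y\<rbrakk>
        \<Longrightarrow> ecomp M n n X X Y g (\<lambda>i\<in>{..<n}. eproj M n X i) = g"
    and ecomp_assoc:
      "\<lbrakk>W \<in> eobj M; X \<in> eobj M; Y \<in> eobj M; Z \<in> eobj M; h \<in> ehom M j Y Z;
        gs \<in> {..<j} \<rightarrow>\<^sub>E ehom M k X Y; fs \<in> {..<k} \<rightarrow>\<^sub>E ehom M n W X\<rbrakk>
        \<Longrightarrow> ecomp M j n W Y Z h (\<lambda>i\<in>{..<j}. ecomp M k n W X Y (gs i) fs)
          = ecomp M k n W X Z (ecomp M j k X Y Z h gs) fs"

record ('o, 'a, 'p, 'b) fset_fun =
  efobj :: "'o \<Rightarrow> 'p"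
  efarr :: "nat \<Rightarrow> 'o \<Rightarrow> 'o \<Rightarrow> 'a \<Rightarrow> 'b"

locale fset_functor =
  fixes M :: "('o, 'a) fset_cat" and N :: "('p, 'b) fset_cat"
    and F :: "('o, 'a, 'p, 'b) fset_fun"
  assumes efobj_in: "X \<in> eobj M \<Longrightarrow> efobj F X \<in> eobj N"
    and efarr_in:
      "\<lbrakk>X \<in> eobj M; Y \<in> eobj M; f \<in> ehom M n X Y\<rbrakk>
        \<Longrightarrow> efarr F n X Y f \<in> ehom N n (efobj F X) (efobj F Y)"
    and efarr_push:
      "\<lbrakk>X \<in> eobj M; Y \<in> eobj M; \<phi> \<in> Fmap n m; f \<in> ehom M n X Y\<rbrakk>
        \<Longrightarrow> efarr F m X Y (push M n m X Y \<phi> f)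
          = push N n m (efobj F X) (efobj F Y) \<phi> (efarr F n X Y f)"
    and efarr_eid: "X \<in> eobj M \<Longrightarrow> efarr F 1 X X (eid M X) = eid N (efobj F X)"
    and efarr_ecomp:
      "\<lbrakk>X \<in> eobj M; Y \<in> eobj M; Z \<in> eobj M; g \<in> ehom M m Y Z; fs \<in> {..<m} \<rightarrow>\<^sub>E ehom M n X Y\<rbrakk>
        \<Longrightarrow> efarr F n X Z (ecomp M m n X Y Z g fs)
          = ecomp N m n (efobj F X) (efobj F Y) (efobj F Z)
              (efarr F m Y Z g) (\<lambda>i\<in>{..<m}. efarr F n X Y (fs i))"

definition fset_functor_ext :: "('o, 'a) fset_cat \<Rightarrow> ('o, 'a, 'p, 'b) fset_fun \<Rightarrow> bool" where
  "fset_functor_ext M F \<longleftrightarrow>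
     efobj F \<in> extensional (eobj M) \<and>
     (\<forall>n X Y f. \<not> (X \<in> eobj M \<and> Y \<in> eobj M \<and> f \<in> ehom M n X Y)
        \<longrightarrow> efarr F n X Y f = undefined)"

definition id_fset_functor :: "('o, 'a) fset_cat \<Rightarrow> ('o, 'a, 'o, 'a) fset_fun" where
  "id_fset_functor M =
     \<lparr>efobj = (\<lambda>X\<in>eobj M. X),
      efarr = (\<lambda>n X Y f.
        if X \<in> eobj M \<and> Y \<in> eobj M \<and> f \<in> ehom M n X Y then f else undefined)\<rparr>"

definition comp_fset_functor ::
  "('o, 'a) fset_cat \<Rightarrow> ('p, 'b, 'q, 'c) fset_fun \<Rightarrow> ('o, 'a, 'p, 'b) fset_fun
    \<Rightarrow> ('o, 'a, 'q, 'c) fset_fun" where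
  "comp_fset_functor M G F =
     \<lparr>efobj = (\<lambda>X\<in>eobj M. efobj G (efobj F X)),
      efarr = (\<lambda>n X Y f.
        if X \<in> eobj M \<and> Y \<in> eobj M \<and> f \<in> ehom M n X Y
        then efarr G n (efobj F X) (efobj F Y) (efarr F n X Y f) else undefined)\<rparr>"

locale fset_trans =
  fixes M :: "('o, 'a) fset_cat" and N :: "('p, 'b) fset_cat"
    and F G :: "('o, 'a, 'p, 'b) fset_fun" and \<alpha> :: "'o \<Rightarrow> 'b"
  assumes component_in: "X \<in> eobj M \<Longrightarrow> \<alpha> X \<in> ehom N 1 (efobj F X) (efobj G X)"
    and naturality:
      "\<lbrakk>X \<in> eobj M; Y \<in> eobj M; f \<in> ehom M n X Y\<rbrakk>
        \<Longrightarrow> ecomp N 1 n (efobj F X) (efobj F Y) (efobj G Y) (\<alpha> Y) (single (efarr F n X Y f))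
          = ecomp N n n (efobj F X) (efobj G X) (efobj G Y) (efarr G n X Y f)
              (\<lambda>i\<in>{..<n}. ecomp N 1 n (efobj F X) (efobj F X) (efobj G X) (\<alpha> X)
                 (single (eproj N n (efobj F X) i)))"

definition fset_hom ::
  "('o, 'a) fset_cat \<Rightarrow> ('p, 'b) fset_cat \<Rightarrow> (('o, 'a, 'p, 'b) fset_fun, 'o \<Rightarrow> 'b) cat" where
  "fset_hom M N =
     \<lparr>obj = {F. fset_functor M N F \<and> fset_functor_ext M F},
      hom = (\<lambda>F G. {\<alpha> \<in> extensional (eobj M). fset_trans M N F G \<alpha>}),
      idt = (\<lambda>F. \<lambda>X\<in>eobj M. eid N (efobj F X)),
      cmp = (\<lambda>F G H \<beta> \<alpha>. \<lambda>X\<in>eobj M.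
        ecomp N 1 1 (efobj F X) (efobj G X) (efobj H X) (\<beta> X) (single (\<alpha> X)))\<rparr>"

definition FSet_CAT ::
  "(('o, 'a) fset_cat, ('o, 'a, 'o, 'a) fset_fun, 'o \<Rightarrow> 'a) two_cat" where
  "FSet_CAT =
     \<lparr>tobj = {M. fset_category M},
      thom = fset_hom,
      tid = id_fset_functor,
      tcomp = (\<lambda>L M N.
        \<lparr>fobj = (\<lambda>(G, F). comp_fset_functor L G F),
         farr = (\<lambda>(G, F) (G', F') (\<beta>, \<alpha>). \<lambda>X\<in>eobj L.
           ecomp N 1 1 (efobj G (efobj F X)) (efobj G (efobj F' X)) (efobj G' (efobj F' X))
             (\<beta> (efobj F' X)) (single (efarr G 1 (efobj F X) (efobj F' X) (\<alpha> X))))\<rparr>)\<rparr>"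

section \<open>Representability\<close>

text \<open>The \<open>j\<close>-th coproduct injection \<open>n \<rightarrow> k \<cdot> n\<close> (for \<open>j < k\<close>).\<close>

definition inj_block :: "nat \<Rightarrow> nat \<Rightarrow> nat \<Rightarrow> nat" where
  "inj_block n j = (\<lambda>x\<in>{..<n}. j * n + x)"

definition exhibits_tensor ::
  "('o, 'a) fset_cat \<Rightarrow> nat \<Rightarrow> 'o \<Rightarrow> 'o \<Rightarrow> 'a \<Rightarrow> bool" where
  "exhibits_tensor M n X Z i \<longleftrightarrow>
     i \<in> ehom M n X Z \<and>
     (\<forall>Y \<in> eobj M. \<forall>k.
        bij_betw
          (\<lambda>g. ecomp M k (k * n) X Z Y g
                 (\<lambda>j\<in>{..<k}. push M n (k * n) X Z (inj_block n j) i))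
          (ehom M k Z Y) (ehom M (k * n) X Y))"

definition representable :: "('o, 'a) fset_cat \<Rightarrow> bool" where
  "representable M \<longleftrightarrow> (\<forall>X \<in> eobj M. \<forall>n. \<exists>Z \<in> eobj M. \<exists>i. exhibits_tensor M n X Z i)"

definition FSet_CAT_rep ::
  "(('o, 'a) fset_cat, ('o, 'a, 'o, 'a) fset_fun, 'o \<Rightarrow> 'a) two_cat" where
  "FSet_CAT_rep = full_sub_two_cat FSet_CAT representable"

section \<open>The underlying-category 2-functor\<close>

definition underlying_cat :: "('o, 'a) fset_cat \<Rightarrow> ('o, 'a) cat" where
  "underlying_cat M =
     \<lparr>obj = eobj M,
      hom = ehom M 1,
      idt = eid M,
      cmp = (\<lambda>X Y Z g f. ecomp M 1 1 X Y Z g (single f))\<rparr>"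

definition underlying_functor ::
  "('o, 'a, 'p, 'b) fset_fun \<Rightarrow> ('o, 'a, 'p, 'b) cat_fun" where
  "underlying_functor F = \<lparr>fobj = efobj F, farr = efarr F 1\<rparr>"

definition underlying ::
  "(('o, 'a) fset_cat, ('o, 'a, 'o, 'a) fset_fun, 'o \<Rightarrow> 'a,
    ('o, 'a) cat, ('o, 'a, 'o, 'a) cat_fun, 'o \<Rightarrow> 'a) two_fun" where
  "underlying =
     \<lparr>map0 = underlying_cat,
      maph = (\<lambda>M N. \<lparr>fobj = underlying_functor, farr = (\<lambda>F G \<alpha>. \<alpha>)\<rparr>)\<rparr>"

end

theory Submission
  imports Defs
begin

text \<open>
  A tensor \<open>y\<^sub>n \<otimes> X\<close> is the same as an object P with projections \<open>p\<^sub>i \<in> M\<^sub>1(P, X)\<close> and a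
  universal element \<open>u \<in> M\<^sub>n(X, P)\<close> such that \<open>p\<^sub>i \<circ> u = \<pi>\<^sub>i\<close> and \<open>u \<circ> (p\<^sub>1, \<dots>, p\<^sub>n) = 1\<close>, and every
  power in the underlying category of a representable M underlies such data. Since
  \<open>f = (f \<circ> (p\<^sub>1, \<dots>, p\<^sub>n)) \<circ> u\<close> for \<open>f \<in> M\<^sub>n(X, Y)\<close>, an enriched functor is determined by its unary
  part, any power-preserving functor K extends by \<open>f \<mapsto> K(f \<circ> (p\<^sub>1, \<dots>, p\<^sub>n)) \<circ> v\<close> where v is the
  universal element of the power \<open>K P\<close>, and naturality at unary arrows implies naturality. So V is
  bijective on 1-cells and on 2-cells. It is moreover surjective on objects: for a category C with
  chosen powers, \<open>M\<^sub>n(X, Y) = C(X\<^sup>n, Y)\<close> is representable with underlying category C.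
\<close>

text \<open>The unit and counit are to be natural up to equality, so choices of powers must not leak
  into the 1-cells. They do not, because the universal element is the only solution u of the
  equations \<open>p\<^sub>i \<circ> u = \<pi>\<^sub>i\<close>: once the projections are known, its
  image under an enriched functor is forced, even though functors in \<open>CAT_fp\<close> preserve
  powers only up to isomorphism. Choices survive in the objects alone. Several enriched categories
  may lie over one category, isomorphic rather than equal, and for this reason the counit can
  consist of identities while the unit cannot. The equational form of tensors is what makes
  preservation automatic: an enriched functor respects equations, whereas a universal property that
  quantifies over all objects of its domain says nothing about the objects of its codomain.\<close>

declare One_nat_def [simp del]

section \<open>2-functors that are bijective on 1-cells and 2-cells\<close>

context two_category
begin

lemma comp1_in:
  assumes "A \<in> tobj T" "B \<in> tobj T" "C \<in> tobj T" "g \<in> obj (thom T B C)" "f \<in> obj (thom T A B)"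
  shows "comp1 T A B C g f \<in> obj (thom T A C)"
  using is_functor.fobj_in[OF tcomp_functor[OF assms(1-3)], of "(g, f)"] assms
  by (simp add: prod_cat_def comp1_def)

lemma comp2_in:
  assumes "A \<in> tobj T" "B \<in> tobj T" "C \<in> tobj T"
    and "g \<in> obj (thom T B C)" "g' \<in> obj (thom T B C)" "f \<in> obj (thom T A B)" "f' \<in> obj (thom T A B)"
    and "\<beta> \<in> hom (thom T B C) g g'" "\<alpha> \<in> hom (thom T A B) f f'"
  shows "comp2 T A B C g g' f f' \<beta> \<alpha>
    \<in> hom (thom T A C) (comp1 T A B C g f) (comp1 T A B C g' f')"
  using is_functor.farr_in[OF tcomp_functor[OF assms(1-3)], of "(g, f)" "(g', f')" "(\<beta>, \<alpha>)"] assms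
  by (simp add: prod_cat_def comp1_def comp2_def)

lemma comp2_idt:
  assumes "A \<in> tobj T" "B \<in> tobj T" "C \<in> tobj T" "g \<in> obj (thom T B C)" "f \<in> obj (thom T A B)"
  shows "comp2 T A B C g g f f (idt (thom T B C) g) (idt (thom T A B) f)
    = idt (thom T A C) (comp1 T A B C g f)"
  using is_functor.farr_idt[OF tcomp_functor[OF assms(1-3)], of "(g, f)"] assms
  by (simp add: prod_cat_def comp1_def comp2_def)

lemma comp2_interchange:
  assumes "A \<in> tobj T" "B \<in> tobj T" "C \<in> tobj T"
    and "g \<in> obj (thom T B C)" "g' \<in> obj (thom T B C)" "g'' \<in> obj (thom T B C)"
    and "f \<in> obj (thom T A B)" "f' \<in> obj (thom T A B)" "f'' \<in> obj (thom T A B)"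
    and "\<beta> \<in> hom (thom T B C) g g'" "\<beta>' \<in> hom (thom T B C) g' g''"
    and "\<alpha> \<in> hom (thom T A B) f f'" "\<alpha>' \<in> hom (thom T A B) f' f''"
  shows "comp2 T A B C g g'' f f''
      (cmp (thom T B C) g g' g'' \<beta>' \<beta>) (cmp (thom T A B) f f' f'' \<alpha>' \<alpha>)
    = cmp (thom T A C) (comp1 T A B C g f) (comp1 T A B C g' f') (comp1 T A B C g'' f'')
        (comp2 T A B C g' g'' f' f'' \<beta>' \<alpha>') (comp2 T A B C g g' f f' \<beta> \<alpha>)"
  using is_functor.farr_cmp[OF tcomp_functor[OF assms(1-3)],
      of "(g, f)" "(g', f')" "(g'', f'')" "(\<beta>', \<alpha>')" "(\<beta>, \<alpha>)"] assms
  by (simp add: prod_cat_def comp1_def comp2_def)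

end

text \<open>The product category hides two laws, preservation of identities and interchange. Stated
  with \<open>comp1\<close> and \<open>comp2\<close> they can be carried from one 2-category to
  another.\<close>

lemma tcomp_functorI:
  assumes "\<And>g f. \<lbrakk>g \<in> obj (thom T B C); f \<in> obj (thom T A B)\<rbrakk>
      \<Longrightarrow> comp1 T A B C g f \<in> obj (thom T A C)"
    and "\<And>g g' f f' \<beta> \<alpha>.
      \<lbrakk>g \<in> obj (thom T B C); g' \<in> obj (thom T B C); f \<in> obj (thom T A B); f' \<in> obj (thom T A B);
       \<beta> \<in> hom (thom T B C) g g'; \<alpha> \<in> hom (thom T A B) f f'\<rbrakk>
      \<Longrightarrow> comp2 T A B C g g' f f' \<beta> \<alpha>
        \<in> hom (thom T A C) (comp1 T A B C g f) (comp1 T A B C g' f')"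
    and "\<And>g f. \<lbrakk>g \<in> obj (thom T B C); f \<in> obj (thom T A B)\<rbrakk>
      \<Longrightarrow> comp2 T A B C g g f f (idt (thom T B C) g) (idt (thom T A B) f)
        = idt (thom T A C) (comp1 T A B C g f)"
    and "\<And>g g' g'' f f' f'' \<beta> \<beta>' \<alpha> \<alpha>'.
      \<lbrakk>g \<in> obj (thom T B C); g' \<in> obj (thom T B C); g'' \<in> obj (thom T B C);
       f \<in> obj (thom T A B); f' \<in> obj (thom T A B); f'' \<in> obj (thom T A B);
       \<beta> \<in> hom (thom T B C) g g'; \<beta>' \<in> hom (thom T B C) g' g'';
       \<alpha> \<in> hom (thom T A B) f f'; \<alpha>' \<in> hom (thom T A B) f' f''\<rbrakk>
      \<Longrightarrow> comp2 T A B C g g'' f f''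
            (cmp (thom T B C) g g' g'' \<beta>' \<beta>) (cmp (thom T A B) f f' f'' \<alpha>' \<alpha>)
        = cmp (thom T A C) (comp1 T A B C g f) (comp1 T A B C g' f') (comp1 T A B C g'' f'')
            (comp2 T A B C g' g'' f' f'' \<beta>' \<alpha>') (comp2 T A B C g g' f f' \<beta> \<alpha>)"
  shows "is_functor (prod_cat (thom T B C) (thom T A B)) (thom T A C) (tcomp T A B C)"
  using assms unfolding comp1_def comp2_def
  by unfold_locales (auto simp: prod_cat_def)

text \<open>S is not assumed to be a 2-category: its operations and their closure on 1-cells are
  given, and its laws are to be reflected along P. Both sides share the type of 2-cells and P leaves
  each 2-cell as it is, so \<open>hom_eq\<close>, \<open>idt_eq\<close>, \<open>cmp_eq\<close> and
  \<open>comp2_eq\<close> can be plain equations.\<close>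

locale two_cat_lifting =
  fixes S :: "('c, 'f, 't) two_cat" and T :: "('d, 'g, 't) two_cat"
    and P :: "('c, 'f, 't, 'd, 'g, 't) two_fun"
  assumes target: "two_category T"
    and map0_in: "A \<in> tobj S \<Longrightarrow> map0 P A \<in> tobj T"
    and map0_surj: "D \<in> tobj T \<Longrightarrow> \<exists>A \<in> tobj S. map0 P A = D"
    and fobj_bij: "\<lbrakk>A \<in> tobj S; B \<in> tobj S\<rbrakk> \<Longrightarrow>
      bij_betw (fobj (maph P A B)) (obj (thom S A B)) (obj (thom T (map0 P A) (map0 P B)))"
    and hom_eq: "\<lbrakk>A \<in> tobj S; B \<in> tobj S; f \<in> obj (thom S A B); g \<in> obj (thom S A B)\<rbrakk> \<Longrightarrow>
      hom (thom S A B) f g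
        = hom (thom T (map0 P A) (map0 P B)) (fobj (maph P A B) f) (fobj (maph P A B) g)"
    and farr_id: "farr (maph P A B) f g \<alpha> = \<alpha>"
    and tid_in: "A \<in> tobj S \<Longrightarrow> tid S A \<in> obj (thom S A A)"
    and map_tid: "A \<in> tobj S \<Longrightarrow> fobj (maph P A A) (tid S A) = tid T (map0 P A)"
    and comp1_in:
      "\<lbrakk>A \<in> tobj S; B \<in> tobj S; C \<in> tobj S; g \<in> obj (thom S B C); f \<in> obj (thom S A B)\<rbrakk>
        \<Longrightarrow> comp1 S A B C g f \<in> obj (thom S A C)"
    and map_comp1:
      "\<lbrakk>A \<in> tobj S; B \<in> tobj S; C \<in> tobj S; g \<in> obj (thom S B C); f \<in> obj (thom S A B)\<rbrakk>
        \<Longrightarrow> fobj (maph P A C) (comp1 S A B C g f)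
          = comp1 T (map0 P A) (map0 P B) (map0 P C) (fobj (maph P B C) g) (fobj (maph P A B) f)"
    and idt_eq: "\<lbrakk>A \<in> tobj S; B \<in> tobj S; f \<in> obj (thom S A B)\<rbrakk>
        \<Longrightarrow> idt (thom S A B) f = idt (thom T (map0 P A) (map0 P B)) (fobj (maph P A B) f)"
    and cmp_eq:
      "\<lbrakk>A \<in> tobj S; B \<in> tobj S;
        f \<in> obj (thom S A B); g \<in> obj (thom S A B); h \<in> obj (thom S A B)\<rbrakk>
        \<Longrightarrow> cmp (thom S A B) f g h \<beta> \<alpha>
          = cmp (thom T (map0 P A) (map0 P B))
              (fobj (maph P A B) f) (fobj (maph P A B) g) (fobj (maph P A B) h) \<beta> \<alpha>"
    and comp2_eq:
      "\<lbrakk>A \<in> tobj S; B \<in> tobj S; C \<in> tobj S;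
        g \<in> obj (thom S B C); g' \<in> obj (thom S B C);
        f \<in> obj (thom S A B); f' \<in> obj (thom S A B)\<rbrakk>
        \<Longrightarrow> comp2 S A B C g g' f f' \<beta> \<alpha>
          = comp2 T (map0 P A) (map0 P B) (map0 P C)
              (fobj (maph P B C) g) (fobj (maph P B C) g')
              (fobj (maph P A B) f) (fobj (maph P A B) f') \<beta> \<alpha>"
begin

interpretation T: two_category T by (rule target)

lemma fobj_inject:
  assumes "fobj (maph P A B) f = fobj (maph P A B) g"
    and "A \<in> tobj S" "B \<in> tobj S" "f \<in> obj (thom S A B)" "g \<in> obj (thom S A B)"
  shows "f = g"
  using bij_betw_imp_inj_on[OF fobj_bij[OF assms(2,3)]] assms by (simp add: inj_on_eq_iff)

lemma fobj_in:
  "\<lbrakk>A \<in> tobj S; B \<in> tobj S; f \<in> obj (thom S A B)\<rbrakk>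
    \<Longrightarrow> fobj (maph P A B) f \<in> obj (thom T (map0 P A) (map0 P B))"
  by (rule bij_betw_apply[OF fobj_bij])

lemmas transfers = map0_in fobj_in hom_eq tid_in map_tid comp1_in map_comp1 idt_eq cmp_eq comp2_eq

lemma thom_category:
  assumes AB: "A \<in> tobj S" "B \<in> tobj S"
  shows "category (thom S A B)"
proof -
  interpret H: category "thom T (map0 P A) (map0 P B)"
    using AB by (simp add: T.thom_category map0_in)
  show ?thesis
    by unfold_locales
      (simp_all add: AB transfers H.idt_in H.cmp_in H.cmp_idt_left H.cmp_idt_right H.cmp_assoc)
qed

text \<open>A law for 1-cells is reflected from T by \<open>fobj_inject\<close>; a law for 2-cells
  is, after rewriting, the law of T itself.\<close>

lemma two_category_source: "two_category S"
proof (rule two_category.intro)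
  show "is_functor (prod_cat (thom S B C) (thom S A B)) (thom S A C) (tcomp S A B C)"
    if "A \<in> tobj S" "B \<in> tobj S" "C \<in> tobj S" for A B C
    by (rule tcomp_functorI)
      (simp_all add: that transfers T.comp2_in T.comp2_idt T.comp2_interchange)
  show "comp1 S A B B (tid S B) f = f"
    if "A \<in> tobj S" "B \<in> tobj S" "f \<in> obj (thom S A B)" for A B f
    by (rule fobj_inject[of A B]) (simp_all add: that transfers T.comp1_tid_left)
  show "comp1 S A A B f (tid S A) = f"
    if "A \<in> tobj S" "B \<in> tobj S" "f \<in> obj (thom S A B)" for A B f
    by (rule fobj_inject[of A B]) (simp_all add: that transfers T.comp1_tid_right)
  show "comp1 S A C D h (comp1 S A B C g f) = comp1 S A B D (comp1 S B C D h g) f"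
    if "A \<in> tobj S" "B \<in> tobj S" "C \<in> tobj S" "D \<in> tobj S"
      "h \<in> obj (thom S C D)" "g \<in> obj (thom S B C)" "f \<in> obj (thom S A B)" for A B C D h g f
    by (rule fobj_inject[of A D]) (simp_all add: that transfers T.comp1_assoc)
qed (simp_all add: thom_category transfers T.comp2_tid_left T.comp2_tid_right T.comp2_assoc)

lemma two_functor_lifting: "two_functor S T P"
proof (rule two_functor.intro)
  show "is_functor (thom S A B) (thom T (map0 P A) (map0 P B)) (maph P A B)"
    if "A \<in> tobj S" "B \<in> tobj S" for A B
    by unfold_locales (simp_all add: that transfers farr_id)
qed (simp_all add: transfers farr_id)

text \<open>An object of T may have several preimages, so one is chosen. On 1-cells between fixed
  objects the preimage is unique and \<open>section1\<close> is a true inverse.\<close>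

definition section0 :: "'d \<Rightarrow> 'c" where
  "section0 B = (SOME A. A \<in> tobj S \<and> map0 P A = B)"

definition section1 :: "'c \<Rightarrow> 'c \<Rightarrow> 'g \<Rightarrow> 'f" where
  "section1 A B = inv_into (obj (thom S A B)) (fobj (maph P A B))"

definition section_fun :: "('d, 'g, 't, 'c, 'f, 't) two_fun" where
  "section_fun = \<lparr>map0 = section0,
     maph = (\<lambda>A B. \<lparr>fobj = section1 (section0 A) (section0 B), farr = (\<lambda>f g \<alpha>. \<alpha>)\<rparr>)\<rparr>"

lemma section0: "B \<in> tobj T \<Longrightarrow> section0 B \<in> tobj S" "B \<in> tobj T \<Longrightarrow> map0 P (section0 B) = B"
  using someI_ex[of "\<lambda>A. A \<in> tobj S \<and> map0 P A = B"] map0_surj[of B]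
  unfolding section0_def by blast+

lemma section1:
  assumes "A \<in> tobj S" "B \<in> tobj S" "f \<in> obj (thom T (map0 P A) (map0 P B))"
  shows "section1 A B f \<in> obj (thom S A B)" "fobj (maph P A B) (section1 A B f) = f"
  using assms fobj_bij[of A B] unfolding section1_def bij_betw_def
  by (metis inv_into_into, metis f_inv_into_f)

lemma two_functor_section: "two_functor T S section_fun"
proof (rule two_functor.intro)
  fix A B assume AB: "A \<in> tobj T" "B \<in> tobj T"
  show "is_functor (thom T A B) (thom S (map0 section_fun A) (map0 section_fun B))
      (maph section_fun A B)"
    by unfold_locales (simp_all add: section_fun_def section0 section1 transfers AB)
next
  show "fobj (maph section_fun A A) (tid T A) = tid S (map0 section_fun A)"
    if "A \<in> tobj T" for A
    by (rule fobj_inject[of "section0 A" "section0 A"])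
      (simp_all add: that section_fun_def section0 section1 transfers T.tid_in)
  show "fobj (maph section_fun A C) (comp1 T A B C g f)
      = comp1 S (map0 section_fun A) (map0 section_fun B) (map0 section_fun C)
          (fobj (maph section_fun B C) g) (fobj (maph section_fun A B) f)"
    if "A \<in> tobj T" "B \<in> tobj T" "C \<in> tobj T" "g \<in> obj (thom T B C)" "f \<in> obj (thom T A B)"
    for A B C g f
    by (rule fobj_inject[of "section0 A" "section0 C"])
      (simp_all add: that section_fun_def section0 section1 transfers T.comp1_in)
qed (simp_all add: section_fun_def section0 section1 transfers)

text \<open>On the cells of T, P after the section is the identity, so identity 1-cells serve as the
  counit. The other composite may move A to a different object over \<open>map0 P A\<close>, and
  there the unit has to be a genuine isomorphism.\<close>

theorem two_equivalence_lifting: "two_equivalence S T P"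
proof -
  \<comment> \<open>A and \<open>section0 (map0 P A)\<close> lie over the same object, whose
    identity 1-cell lifts in both directions. The two lifts are mutually inverse because their
    composites lie over identities.\<close>
  let ?\<eta> = "\<lambda>A. section1 A (section0 (map0 P A)) (tid T (map0 P A))"
  let ?\<eta>' = "\<lambda>A. section1 (section0 (map0 P A)) A (tid T (map0 P A))"
  have comp_simps: "map0 (comp_two_fun section_fun P) A = section0 (map0 P A)"
      "fobj (maph (comp_two_fun section_fun P) A B) f
        = section1 (section0 (map0 P A)) (section0 (map0 P B)) (fobj (maph P A B) f)"
      "farr (maph (comp_two_fun section_fun P) A B) f g \<alpha> = \<alpha>"
      "map0 (id_two_fun :: ('c,'f,'t,'c,'f,'t) two_fun) A = A"
      "fobj (maph id_two_fun A B) f = f"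
      "farr (maph (id_two_fun :: ('c,'f,'t,'c,'f,'t) two_fun) A B) f g \<alpha> = \<alpha>" for A B f g \<alpha>
    by (simp_all add: comp_two_fun_def section_fun_def id_two_fun_def farr_id)
  have comp_simps': "map0 (comp_two_fun P section_fun) A = map0 P (section0 A)"
      "fobj (maph (comp_two_fun P section_fun) A B) k
        = fobj (maph P (section0 A) (section0 B)) (section1 (section0 A) (section0 B) k)"
      "farr (maph (comp_two_fun P section_fun) A B) k l \<alpha> = \<alpha>"
      "map0 (id_two_fun :: ('d,'g,'t,'d,'g,'t) two_fun) A = A"
      "fobj (maph id_two_fun A B) k = k"
      "farr (maph (id_two_fun :: ('d,'g,'t,'d,'g,'t) two_fun) A B) k l \<alpha> = \<alpha>" for A B k l \<alpha>
    by (simp_all add: comp_two_fun_def section_fun_def id_two_fun_def farr_id)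
  have "two_nat_trans S S id_two_fun (comp_two_fun section_fun P) ?\<eta>"
  proof (rule two_nat_trans.intro, unfold comp_simps)
    fix A B f assume *: "A \<in> tobj S" "B \<in> tobj S" "f \<in> obj (thom S A B)"
    show "comp1 S A B (section0 (map0 P B)) (?\<eta> B) f
        = comp1 S A (section0 (map0 P A)) (section0 (map0 P B))
          (section1 (section0 (map0 P A)) (section0 (map0 P B)) (fobj (maph P A B) f)) (?\<eta> A)"
      by (rule fobj_inject[of A "section0 (map0 P B)"])
        (simp_all add: * comp_simps section0 section1 transfers T.tid_in
          T.comp1_tid_left T.comp1_tid_right)
  qed (simp_all add: comp_simps section0 section1 transfers T.tid_in
      T.comp2_tid_left T.comp2_tid_right)
  moreover have "iso1 S A (section0 (map0 P A)) (?\<eta> A)" if A: "A \<in> tobj S" for A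
    unfolding iso1_def
  proof (intro conjI bexI[of _ "?\<eta>' A"])
    show "comp1 S A (section0 (map0 P A)) A (?\<eta>' A) (?\<eta> A) = tid S A"
      by (rule fobj_inject[of A A])
        (simp_all add: A section0 section1 transfers T.tid_in T.comp1_tid_left)
    show "comp1 S (section0 (map0 P A)) A (section0 (map0 P A)) (?\<eta> A) (?\<eta>' A)
        = tid S (section0 (map0 P A))"
      by (rule fobj_inject[of "section0 (map0 P A)" "section0 (map0 P A)"])
        (simp_all add: A section0 section1 transfers T.tid_in T.comp1_tid_left)
  qed (simp_all add: A section0 section1 transfers T.tid_in)
  ultimately have unit: "two_nat_iso S S id_two_fun (comp_two_fun section_fun P) ?\<eta>"
    by (simp add: two_nat_iso_def comp_simps)
  have "two_nat_trans T T (comp_two_fun P section_fun) id_two_fun (tid T)"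
    by unfold_locales
      (auto simp: comp_simps' section0 section1 T.tid_in T.comp1_tid_left T.comp1_tid_right
        T.comp2_tid_left T.comp2_tid_right)
  moreover have "iso1 T B B (tid T B)" if "B \<in> tobj T" for B
    unfolding iso1_def using that T.tid_in T.comp1_tid_left by blast
  ultimately have "two_nat_iso T T (comp_two_fun P section_fun) id_two_fun (tid T)"
    by (simp add: two_nat_iso_def comp_simps' section0)
  with unit two_category_source target two_functor_lifting two_functor_section show ?thesis
    unfolding two_equivalence_def by blast
qed

end

section \<open>The 2-category of categories with finite powers\<close>

lemma functor_ext_eqI:
  assumes "functor_ext C F" "functor_ext C G"
    and "\<And>X. X \<in> obj C \<Longrightarrow> fobj F X = fobj G X"
    and "\<And>X Y f. \<lbrakk>X \<in> obj C; Y \<in> obj C; f \<in> hom C X Y\<rbrakk> \<Longrightarrow> farr F X Y f = farr G X Y f"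
  shows "F = G"
proof -
  have "fobj F = fobj G"
    using assms by (intro extensionalityI[of _ "obj C"]) (auto simp: functor_ext_def)
  moreover have "farr F = farr G"
    using assms unfolding functor_ext_def by (intro ext) metis
  ultimately show ?thesis by simp
qed

lemma functor_ext_id: "functor_ext C (id_functor C)"
  by (simp add: functor_ext_def id_functor_def)

lemma functor_ext_comp: "functor_ext C (comp_functor C G F)"
  by (simp add: functor_ext_def comp_functor_def)

lemma is_functor_id: "category C \<Longrightarrow> is_functor C C (id_functor C)"
  by unfold_locales (simp_all add: id_functor_def category.idt_in category.cmp_in)

lemma is_functor_comp:
  assumes "category C" "is_functor C D F" "is_functor D E G"
  shows "is_functor C E (comp_functor C G F)"
proof -
  interpret C: category C by fact
  interpret F: is_functor C D F by fact
  interpret G: is_functor D E G by fact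
  show ?thesis
    by unfold_locales
      (simp_all add: comp_functor_def C.idt_in C.cmp_in F.fobj_in F.farr_in F.farr_idt F.farr_cmp
        G.fobj_in G.farr_in G.farr_idt G.farr_cmp)
qed

text \<open>Indices from n on carry no information, but an extensional functor sends junk arrows
  there to \<open>undefined\<close>; the projection families compared below agree only under
  n.\<close>

lemma is_power_cong:
  assumes "\<And>i. i < n \<Longrightarrow> p i = q i"
  shows "is_power C n X P p \<longleftrightarrow> is_power C n X P q"
  using assms unfolding is_power_def by simp

lemma preserves_finite_powers_id: "preserves_finite_powers C C (id_functor C)"
  unfolding preserves_finite_powers_def
proof (intro ballI allI impI)
  fix X n P p assume "X \<in> obj C" and *: "is_power C n X P p"
  then show "is_power C n (fobj (id_functor C) X) (fobj (id_functor C) P)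
      (\<lambda>i. farr (id_functor C) P X (p i))"
    by (subst is_power_cong[where q = p]) (auto simp: is_power_def id_functor_def)
qed

lemma preserves_finite_powers_comp:
  assumes "is_functor C D F" "preserves_finite_powers C D F" "preserves_finite_powers D E G"
  shows "preserves_finite_powers C E (comp_functor C G F)"
  unfolding preserves_finite_powers_def
proof (intro ballI allI impI)
  fix X n P p assume X: "X \<in> obj C" and *: "is_power C n X P p"
  have "is_power E n (fobj G (fobj F X)) (fobj G (fobj F P))
      (\<lambda>i. farr G (fobj F P) (fobj F X) (farr F P X (p i)))"
    using assms X * unfolding preserves_finite_powers_def by (blast intro: is_functor.fobj_in)
  then show "is_power E n (fobj (comp_functor C G F) X) (fobj (comp_functor C G F) P)
      (\<lambda>i. farr (comp_functor C G F) P X (p i))"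
    using X *
    by (subst is_power_cong[where q = "\<lambda>i. farr G (fobj F P) (fobj F X) (farr F P X (p i))"])
      (auto simp: is_power_def comp_functor_def)
qed

lemma category_fp_hom:
  assumes "category C" "category D"
  shows "category (fp_hom C D)"
proof -
  interpret C: category C by fact
  interpret D: category D by fact
  show ?thesis
  proof (rule category.intro)
    fix F assume "F \<in> obj (fp_hom C D)"
    then interpret F: is_functor C D F by (simp add: fp_hom_def)
    show "idt (fp_hom C D) F \<in> hom (fp_hom C D) F F"
      by (auto simp: fp_hom_def nat_trans_def D.idt_in F.fobj_in F.farr_in
          D.cmp_idt_left D.cmp_idt_right)
  next
    fix F G H \<alpha> \<beta>
    assume "F \<in> obj (fp_hom C D)" "G \<in> obj (fp_hom C D)" "H \<in> obj (fp_hom C D)"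
      and ab: "\<beta> \<in> hom (fp_hom C D) G H" "\<alpha> \<in> hom (fp_hom C D) F G"
    then interpret F: is_functor C D F + G: is_functor C D G + H: is_functor C D H
      by (simp_all add: fp_hom_def)
    interpret \<alpha>: nat_trans C D F G \<alpha> using ab by (simp add: fp_hom_def)
    interpret \<beta>: nat_trans C D G H \<beta> using ab by (simp add: fp_hom_def)
    have "nat_trans C D F H (cmp (fp_hom C D) F G H \<beta> \<alpha>)"
    proof
      fix X Y f assume *: "X \<in> obj C" "Y \<in> obj C" "f \<in> hom C X Y"
      note D.cmp_assoc[symmetric, simp] F.fobj_in[simp] F.farr_in[simp] G.fobj_in[simp]
        G.farr_in[simp] H.fobj_in[simp] H.farr_in[simp] \<alpha>.component_in[simp] \<beta>.component_in[simp]
      have "cmp D (fobj F X) (fobj F Y) (fobj H Y)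
            (cmp D (fobj F Y) (fobj G Y) (fobj H Y) (\<beta> Y) (\<alpha> Y)) (farr F X Y f)
          = cmp D (fobj F X) (fobj G Y) (fobj H Y) (\<beta> Y)
              (cmp D (fobj F X) (fobj G X) (fobj G Y) (farr G X Y f) (\<alpha> X))"
        using * by (simp add: \<alpha>.naturality)
      also have "\<dots> = cmp D (fobj F X) (fobj G X) (fobj H Y)
            (cmp D (fobj G X) (fobj G Y) (fobj H Y) (\<beta> Y) (farr G X Y f)) (\<alpha> X)"
        using * by simp
      finally show "cmp D (fobj F X) (fobj F Y) (fobj H Y)
            (cmp (fp_hom C D) F G H \<beta> \<alpha> Y) (farr F X Y f)
          = cmp D (fobj F X) (fobj H X) (fobj H Y) (farr H X Y f)
              (cmp (fp_hom C D) F G H \<beta> \<alpha> X)"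
        using * by (simp add: fp_hom_def \<beta>.naturality)
    qed (simp add: fp_hom_def D.cmp_in F.fobj_in G.fobj_in H.fobj_in
        \<alpha>.component_in \<beta>.component_in)
    then show "cmp (fp_hom C D) F G H \<beta> \<alpha> \<in> hom (fp_hom C D) F H"
      by (simp add: fp_hom_def)
  qed (auto simp: fp_hom_def is_functor.fobj_in nat_trans.component_in
      D.cmp_idt_left D.cmp_idt_right D.cmp_assoc intro: extensionalityI[of _ "obj C"])
qed

lemma comp1_CAT_fp: "comp1 CAT_fp C D E G F = comp_functor C G F"
  by (simp add: comp1_def CAT_fp_def)

lemma comp2_CAT_fp: "comp2 CAT_fp C D E G G' F F' \<beta> \<alpha> =
    (\<lambda>X\<in>obj C. cmp E (fobj G (fobj F X)) (fobj G (fobj F' X)) (fobj G' (fobj F' X))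
       (\<beta> (fobj F' X)) (farr G (fobj F X) (fobj F' X) (\<alpha> X)))"
  by (simp add: comp2_def CAT_fp_def)

lemma thom_CAT_fp: "thom CAT_fp = fp_hom"
  by (simp add: CAT_fp_def)

lemma tid_CAT_fp: "tid CAT_fp = id_functor"
  by (simp add: CAT_fp_def)

lemma obj_fp_hom: "F \<in> obj (fp_hom C D) \<longleftrightarrow>
    is_functor C D F \<and> functor_ext C F \<and> preserves_finite_powers C D F"
  by (simp add: fp_hom_def)

lemma hom_fp_hom: "\<alpha> \<in> hom (fp_hom C D) F G \<longleftrightarrow> \<alpha> \<in> extensional (obj C) \<and> nat_trans C D F G \<alpha>"
  by (simp add: fp_hom_def)

lemma comp_functor_in:
  assumes "category C" "F \<in> obj (fp_hom C D)" "G \<in> obj (fp_hom D E)"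
  shows "comp_functor C G F \<in> obj (fp_hom C E)"
  using assms
  by (simp add: obj_fp_hom functor_ext_comp is_functor_comp[where D = D]
      preserves_finite_powers_comp[where D = D])

text \<open>Here the 2-category laws are verified on components; the enriched side inherits them
  through \<open>two_cat_lifting\<close>.\<close>

lemma two_category_CAT_fp:
  "two_category (CAT_fp :: (('o, 'a) cat, ('o, 'a, 'o, 'a) cat_fun, 'o \<Rightarrow> 'a) two_cat)"
    (is "two_category ?T")
proof (rule two_category.intro)
  fix C D assume "C \<in> tobj ?T" "D \<in> tobj ?T"
  then show "category (thom ?T C D)"
    by (simp add: CAT_fp_def category_fp_hom)
next
  fix C assume "C \<in> tobj ?T"
  then show "tid ?T C \<in> obj (thom ?T C C)"
    by (simp add: CAT_fp_def obj_fp_hom is_functor_id functor_ext_id preserves_finite_powers_id)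
next
  fix C D E assume "C \<in> tobj ?T" "D \<in> tobj ?T" "E \<in> tobj ?T"
  then interpret C: category C + D: category D + E: category E
    by (simp_all add: CAT_fp_def)
  show "is_functor (prod_cat (thom ?T D E) (thom ?T C D)) (thom ?T C E) (tcomp ?T C D E)"
  proof (rule tcomp_functorI, unfold thom_CAT_fp comp1_CAT_fp comp2_CAT_fp)
    fix G F assume GF: "G \<in> obj (fp_hom D E)" "F \<in> obj (fp_hom C D)"
    then interpret G: is_functor D E G + F: is_functor C D F by (simp_all add: obj_fp_hom)
    show "comp_functor C G F \<in> obj (fp_hom C E)"
      using GF C.category_axioms by (intro comp_functor_in)
    show "(\<lambda>X\<in>obj C. cmp E (fobj G (fobj F X)) (fobj G (fobj F X)) (fobj G (fobj F X))
          (idt (fp_hom D E) G (fobj F X)) (farr G (fobj F X) (fobj F X) (idt (fp_hom C D) F X)))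
        = idt (fp_hom C E) (comp_functor C G F)"
      by (auto simp: fp_hom_def comp_functor_def F.fobj_in G.fobj_in G.farr_idt E.idt_in
          E.cmp_idt_left)
  next
    fix G G' F F' \<beta> \<alpha>
    assume "G \<in> obj (fp_hom D E)" "G' \<in> obj (fp_hom D E)"
      "F \<in> obj (fp_hom C D)" "F' \<in> obj (fp_hom C D)"
      and ab: "\<beta> \<in> hom (fp_hom D E) G G'" "\<alpha> \<in> hom (fp_hom C D) F F'"
    then interpret G: is_functor D E G + G': is_functor D E G' +
        F: is_functor C D F + F': is_functor C D F' by (simp_all add: obj_fp_hom)
    interpret \<beta>: nat_trans D E G G' \<beta> using ab by (simp add: hom_fp_hom)
    interpret \<alpha>: nat_trans C D F F' \<alpha> using ab by (simp add: hom_fp_hom)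
    note [simp] = F.fobj_in F.farr_in F'.fobj_in F'.farr_in G.fobj_in G.farr_in G'.fobj_in
      G'.farr_in \<alpha>.component_in \<beta>.component_in
    show "(\<lambda>X\<in>obj C. cmp E (fobj G (fobj F X)) (fobj G (fobj F' X)) (fobj G' (fobj F' X))
          (\<beta> (fobj F' X)) (farr G (fobj F X) (fobj F' X) (\<alpha> X)))
        \<in> hom (fp_hom C E) (comp_functor C G F) (comp_functor C G' F')"
      unfolding hom_fp_hom
    proof
      show "nat_trans C E (comp_functor C G F) (comp_functor C G' F')
        (\<lambda>X\<in>obj C. cmp E (fobj G (fobj F X)) (fobj G (fobj F' X)) (fobj G' (fobj F' X))
          (\<beta> (fobj F' X)) (farr G (fobj F X) (fobj F' X) (\<alpha> X)))"
      proof
        fix X Y f assume *: "X \<in> obj C" "Y \<in> obj C" "f \<in> hom C X Y"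
        \<comment> \<open>Two squares are pasted: G applied to that of \<open>\<alpha>\<close> at f,
          then that of \<open>\<beta>\<close> at \<open>farr F' X Y f\<close>.\<close>
        have "cmp E (fobj G (fobj F X)) (fobj G (fobj F Y)) (fobj G' (fobj F' Y))
            (cmp E (fobj G (fobj F Y)) (fobj G (fobj F' Y)) (fobj G' (fobj F' Y)) (\<beta> (fobj F' Y))
              (farr G (fobj F Y) (fobj F' Y) (\<alpha> Y)))
            (farr G (fobj F X) (fobj F Y) (farr F X Y f))
          = cmp E (fobj G (fobj F X)) (fobj G (fobj F' Y)) (fobj G' (fobj F' Y)) (\<beta> (fobj F' Y))
            (farr G (fobj F X) (fobj F' Y)
              (cmp D (fobj F X) (fobj F Y) (fobj F' Y) (\<alpha> Y) (farr F X Y f)))"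
          using * by (simp add: E.cmp_assoc[symmetric] G.farr_cmp)
        also have "\<dots> = cmp E (fobj G (fobj F X)) (fobj G (fobj F' X)) (fobj G' (fobj F' Y))
            (cmp E (fobj G (fobj F' X)) (fobj G (fobj F' Y)) (fobj G' (fobj F' Y))
              (\<beta> (fobj F' Y)) (farr G (fobj F' X) (fobj F' Y) (farr F' X Y f)))
            (farr G (fobj F X) (fobj F' X) (\<alpha> X))"
          using * by (simp add: E.cmp_assoc[symmetric] G.farr_cmp \<alpha>.naturality)
        also have "\<dots> = cmp E (fobj G (fobj F X)) (fobj G' (fobj F' X)) (fobj G' (fobj F' Y))
            (farr G' (fobj F' X) (fobj F' Y) (farr F' X Y f))
            (cmp E (fobj G (fobj F X)) (fobj G (fobj F' X)) (fobj G' (fobj F' X))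
              (\<beta> (fobj F' X)) (farr G (fobj F X) (fobj F' X) (\<alpha> X)))"
          using * by (simp add: E.cmp_assoc \<beta>.naturality[of "fobj F' X" "fobj F' Y"])
        finally show "cmp E (fobj (comp_functor C G F) X) (fobj (comp_functor C G F) Y)
            (fobj (comp_functor C G' F') Y)
            ((\<lambda>X\<in>obj C. cmp E (fobj G (fobj F X)) (fobj G (fobj F' X)) (fobj G' (fobj F' X))
              (\<beta> (fobj F' X)) (farr G (fobj F X) (fobj F' X) (\<alpha> X))) Y)
            (farr (comp_functor C G F) X Y f)
          = cmp E (fobj (comp_functor C G F) X) (fobj (comp_functor C G' F') X)
            (fobj (comp_functor C G' F') Y)
            (farr (comp_functor C G' F') X Y f)
            ((\<lambda>X\<in>obj C. cmp E (fobj G (fobj F X)) (fobj G (fobj F' X)) (fobj G' (fobj F' X))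
              (\<beta> (fobj F' X)) (farr G (fobj F X) (fobj F' X) (\<alpha> X))) X)"
          using * by (simp add: comp_functor_def)
      qed (simp add: comp_functor_def E.cmp_in)
    qed simp
  next
    fix G G' G'' F F' F'' \<beta> \<beta>' \<alpha> \<alpha>'
    assume "G \<in> obj (fp_hom D E)" "G' \<in> obj (fp_hom D E)" "G'' \<in> obj (fp_hom D E)"
      "F \<in> obj (fp_hom C D)" "F' \<in> obj (fp_hom C D)" "F'' \<in> obj (fp_hom C D)"
      and ab: "\<beta> \<in> hom (fp_hom D E) G G'" "\<beta>' \<in> hom (fp_hom D E) G' G''"
        "\<alpha> \<in> hom (fp_hom C D) F F'" "\<alpha>' \<in> hom (fp_hom C D) F' F''"
    then interpret G: is_functor D E G + G': is_functor D E G' + G'': is_functor D E G'' +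
        F: is_functor C D F + F': is_functor C D F' + F'': is_functor C D F''
      by (simp_all add: obj_fp_hom)
    interpret \<beta>: nat_trans D E G G' \<beta> using ab by (simp add: hom_fp_hom)
    interpret \<alpha>: nat_trans C D F F' \<alpha> using ab by (simp add: hom_fp_hom)
    interpret \<beta>': nat_trans D E G' G'' \<beta>' using ab by (simp add: hom_fp_hom)
    interpret \<alpha>': nat_trans C D F' F'' \<alpha>' using ab by (simp add: hom_fp_hom)
    note [simp] = F.fobj_in F.farr_in F'.fobj_in F'.farr_in F''.fobj_in F''.farr_in
      G.fobj_in G.farr_in G'.fobj_in G'.farr_in G''.fobj_in G''.farr_in
      \<alpha>.component_in \<beta>.component_in \<alpha>'.component_in \<beta>'.component_in
    \<comment> \<open>Interchange hinges on the square in the middle, the naturality of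
      \<open>\<beta>\<close> at the arrow \<open>\<alpha>' X\<close>.\<close>
    have eq: "cmp E (fobj G (fobj F X)) (fobj G (fobj F'' X)) (fobj G'' (fobj F'' X))
          (cmp E (fobj G (fobj F'' X)) (fobj G' (fobj F'' X)) (fobj G'' (fobj F'' X))
            (\<beta>' (fobj F'' X)) (\<beta> (fobj F'' X)))
          (farr G (fobj F X) (fobj F'' X)
            (cmp D (fobj F X) (fobj F' X) (fobj F'' X) (\<alpha>' X) (\<alpha> X)))
        = cmp E (fobj G (fobj F X)) (fobj G' (fobj F' X)) (fobj G'' (fobj F'' X))
          (cmp E (fobj G' (fobj F' X)) (fobj G' (fobj F'' X)) (fobj G'' (fobj F'' X))
            (\<beta>' (fobj F'' X)) (farr G' (fobj F' X) (fobj F'' X) (\<alpha>' X)))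
          (cmp E (fobj G (fobj F X)) (fobj G (fobj F' X)) (fobj G' (fobj F' X))
            (\<beta> (fobj F' X)) (farr G (fobj F X) (fobj F' X) (\<alpha> X)))"
      (is "?l = ?r") if X: "X \<in> obj C" for X
    proof -
      have "?l = cmp E (fobj G (fobj F X)) (fobj G' (fobj F'' X)) (fobj G'' (fobj F'' X))
          (\<beta>' (fobj F'' X))
          (cmp E (fobj G (fobj F X)) (fobj G (fobj F' X)) (fobj G' (fobj F'' X))
            (cmp E (fobj G (fobj F' X)) (fobj G (fobj F'' X)) (fobj G' (fobj F'' X))
              (\<beta> (fobj F'' X)) (farr G (fobj F' X) (fobj F'' X) (\<alpha>' X)))
            (farr G (fobj F X) (fobj F' X) (\<alpha> X)))"
        using X by (simp add: E.cmp_assoc[symmetric] E.cmp_in G.farr_cmp)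
      also have "\<dots> = ?r"
        using X by (simp only: \<beta>.naturality[OF _ _ \<alpha>'.component_in[OF X]] F'.fobj_in F''.fobj_in)
          (simp add: E.cmp_assoc[symmetric] E.cmp_in)
      finally show ?thesis .
    qed
    show "(\<lambda>X\<in>obj C. cmp E (fobj G (fobj F X)) (fobj G (fobj F'' X)) (fobj G'' (fobj F'' X))
          (cmp (fp_hom D E) G G' G'' \<beta>' \<beta> (fobj F'' X))
          (farr G (fobj F X) (fobj F'' X) (cmp (fp_hom C D) F F' F'' \<alpha>' \<alpha> X)))
        = cmp (fp_hom C E) (comp_functor C G F) (comp_functor C G' F') (comp_functor C G'' F'')
          (\<lambda>X\<in>obj C. cmp E (fobj G' (fobj F' X)) (fobj G' (fobj F'' X)) (fobj G'' (fobj F'' X))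
            (\<beta>' (fobj F'' X)) (farr G' (fobj F' X) (fobj F'' X) (\<alpha>' X)))
          (\<lambda>X\<in>obj C. cmp E (fobj G (fobj F X)) (fobj G (fobj F' X)) (fobj G' (fobj F' X))
            (\<beta> (fobj F' X)) (farr G (fobj F X) (fobj F' X) (\<alpha> X)))"
      by (rule ext) (simp add: fp_hom_def comp_functor_def eq)
  qed
next
  fix C D F assume CD: "C \<in> tobj ?T" "D \<in> tobj ?T" and F: "F \<in> obj (thom ?T C D)"
  then interpret F: is_functor C D F by (simp add: CAT_fp_def obj_fp_hom)
  have ext: "functor_ext C F" using F by (simp add: CAT_fp_def obj_fp_hom)
  show "comp1 ?T C D D (tid ?T D) F = F"
    unfolding comp1_CAT_fp tid_CAT_fp
    by (rule functor_ext_eqI[OF functor_ext_comp ext])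
      (simp_all add: comp_functor_def id_functor_def F.fobj_in F.farr_in)
  show "comp1 ?T C C D F (tid ?T C) = F"
    unfolding comp1_CAT_fp tid_CAT_fp
    by (rule functor_ext_eqI[OF functor_ext_comp ext])
      (simp_all add: comp_functor_def id_functor_def F.fobj_in F.farr_in)
next
  fix B C D E H G F
  assume "F \<in> obj (thom ?T B C)"
  then interpret F: is_functor B C F by (simp add: CAT_fp_def obj_fp_hom)
  show "comp1 ?T B D E H (comp1 ?T B C D G F) = comp1 ?T B C E (comp1 ?T C D E H G) F"
    unfolding comp1_CAT_fp
    by (rule functor_ext_eqI[OF functor_ext_comp functor_ext_comp])
      (simp_all add: comp_functor_def F.fobj_in F.farr_in)
next
  fix C D F F' \<alpha> assume CD: "C \<in> tobj ?T" "D \<in> tobj ?T"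
    and F: "F \<in> obj (thom ?T C D)" "F' \<in> obj (thom ?T C D)" and a: "\<alpha> \<in> hom (thom ?T C D) F F'"
  interpret F: is_functor C D F using F by (simp add: CAT_fp_def obj_fp_hom)
  interpret F': is_functor C D F' using F by (simp add: CAT_fp_def obj_fp_hom)
  interpret D: category D using CD by (simp add: CAT_fp_def)
  interpret \<alpha>: nat_trans C D F F' \<alpha> using a by (simp add: thom_CAT_fp hom_fp_hom)
  have ext: "\<alpha> \<in> extensional (obj C)" using a by (simp add: thom_CAT_fp hom_fp_hom)
  show "comp2 ?T C D D (tid ?T D) (tid ?T D) F F' (idt (thom ?T D D) (tid ?T D)) \<alpha> = \<alpha>"
    unfolding comp2_CAT_fp tid_CAT_fp thom_CAT_fp
    by (rule extensionalityI[OF _ ext])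
      (simp_all add: fp_hom_def id_functor_def F.fobj_in F'.fobj_in \<alpha>.component_in D.cmp_idt_left)
  show "comp2 ?T C C D F F' (tid ?T C) (tid ?T C) \<alpha> (idt (thom ?T C C) (tid ?T C)) = \<alpha>"
    unfolding comp2_CAT_fp tid_CAT_fp thom_CAT_fp
    by (rule extensionalityI[OF _ ext])
      (simp_all add: fp_hom_def id_functor_def F.fobj_in F'.fobj_in F.farr_idt
        \<alpha>.component_in D.cmp_idt_right)
next
  fix B C D E H H' G G' F F' \<gamma> \<beta> \<alpha>
  assume "B \<in> tobj ?T" "C \<in> tobj ?T" "D \<in> tobj ?T" "E \<in> tobj ?T"
    "H \<in> obj (thom ?T D E)" "H' \<in> obj (thom ?T D E)" "G \<in> obj (thom ?T C D)"
    "G' \<in> obj (thom ?T C D)" "F \<in> obj (thom ?T B C)" "F' \<in> obj (thom ?T B C)"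
    and abc: "\<gamma> \<in> hom (thom ?T D E) H H'" "\<beta> \<in> hom (thom ?T C D) G G'"
      "\<alpha> \<in> hom (thom ?T B C) F F'"
  then interpret E: category E + H: is_functor D E H + H': is_functor D E H' +
      G: is_functor C D G + G': is_functor C D G' + F: is_functor B C F + F': is_functor B C F'
    by (simp_all add: CAT_fp_def obj_fp_hom)
  interpret \<gamma>: nat_trans D E H H' \<gamma> using abc by (simp add: thom_CAT_fp hom_fp_hom)
  interpret \<beta>: nat_trans C D G G' \<beta> using abc by (simp add: thom_CAT_fp hom_fp_hom)
  interpret \<alpha>: nat_trans B C F F' \<alpha> using abc by (simp add: thom_CAT_fp hom_fp_hom)
  show "comp2 ?T B D E H H' (comp1 ?T B C D G F) (comp1 ?T B C D G' F') \<gamma>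
        (comp2 ?T B C D G G' F F' \<beta> \<alpha>)
      = comp2 ?T B C E (comp1 ?T C D E H G) (comp1 ?T C D E H' G') F F'
        (comp2 ?T C D E H H' G G' \<gamma> \<beta>) \<alpha>"
    unfolding comp1_CAT_fp comp2_CAT_fp
    by (rule ext)
      (simp add: comp_functor_def F.fobj_in F'.fobj_in G.fobj_in G.farr_in G'.fobj_in
        H.fobj_in H.farr_in H.farr_cmp H'.fobj_in \<alpha>.component_in \<beta>.component_in
        \<gamma>.component_in E.cmp_assoc)
qed

section \<open>Tensors as equational powers\<close>

lemma single_0 [simp]: "single x 0 = x"
  by (simp add: single_def)

lemma single_in [simp]: "single x \<in> {..<1} \<rightarrow>\<^sub>E A \<longleftrightarrow> x \<in> A"
  by (auto simp: single_def)

text \<open>Unary tuples arise both as restrictions and as \<open>single\<close>; the latter becomes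
  the normal form on which the unary laws act.\<close>

lemma restrict_single [simp]: "restrict f {..<1} = single (f 0)"
  by (auto simp: single_def)

context fset_category
begin

lemma eproj_in [simp]: "\<lbrakk>X \<in> eobj M; i < n\<rbrakk> \<Longrightarrow> eproj M n X i \<in> ehom M n X X"
  unfolding eproj_def by (rule push_in) (simp_all add: eid_in)

lemma push_eproj:
  assumes "X \<in> eobj M" "\<phi> \<in> Fmap n m" "i < n"
  shows "push M n m X X \<phi> (eproj M n X i) = eproj M m X (\<phi> i)"
proof -
  have "compose {..<1} \<phi> (single i) = single (\<phi> i)"
    by (simp add: compose_def)
  then show ?thesis
    unfolding eproj_def using assms by (subst push_compose[symmetric]) (simp_all add: eid_in)
qed

lemma eproj_1 [simp]: "X \<in> eobj M \<Longrightarrow> eproj M 1 X 0 = eid M X"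
  using push_id[of X X "eid M X" 1] by (simp add: eproj_def eid_in)

text \<open>Since f equals f composed with the projections, naturality moves the action of
  \<open>\<phi>\<close> onto them. Hence a map compatible with composites and projections is
  compatible with \<open>push\<close>.\<close>

lemma push_eq_ecomp:
  assumes "X \<in> eobj M" "Y \<in> eobj M" "\<phi> \<in> Fmap n m" "f \<in> ehom M n X Y"
  shows "push M n m X Y \<phi> f = ecomp M n m X X Y f (\<lambda>i\<in>{..<n}. eproj M m X (\<phi> i))"
proof -
  have "push M n m X Y \<phi> f = push M n m X Y \<phi> (ecomp M n n X X Y f (\<lambda>i\<in>{..<n}. eproj M n X i))"
    using assms by (simp add: ecomp_proj)
  also have "\<dots> = ecomp M n m X X Y f
      (\<lambda>i\<in>{..<n}. push M n m X X \<phi> ((\<lambda>i\<in>{..<n}. eproj M n X i) i))"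
    using assms by (intro ecomp_natural_inner) auto
  also have "\<dots> = ecomp M n m X X Y f (\<lambda>i\<in>{..<n}. eproj M m X (\<phi> i))"
    using assms by (simp add: push_eproj cong: restrict_cong)
  finally show ?thesis .
qed

lemma eid_ecomp [simp]:
  assumes "X \<in> eobj M" "Y \<in> eobj M" "f \<in> ehom M n X Y"
  shows "ecomp M 1 n X Y Y (eid M Y) (single f) = f"
  using proj_ecomp[of X Y "single f" 1 n 0] assms by simp

lemma ecomp_eid [simp]:
  assumes "X \<in> eobj M" "Y \<in> eobj M" "f \<in> ehom M 1 X Y"
  shows "ecomp M 1 1 X X Y f (single (eid M X)) = f"
  using ecomp_proj[of X Y f 1] assms by simp

lemma ecomp_single_assoc:
  assumes "W \<in> eobj M" "X \<in> eobj M" "Y \<in> eobj M" "Z \<in> eobj M"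
    and "h \<in> ehom M 1 Y Z" "g \<in> ehom M k X Y" "fs \<in> {..<k} \<rightarrow>\<^sub>E ehom M n W X"
  shows "ecomp M 1 n W Y Z h (single (ecomp M k n W X Y g fs))
    = ecomp M k n W X Z (ecomp M 1 k X Y Z h (single g)) fs"
  using ecomp_assoc[of W X Y Z h 1 "single g" k fs n] assms by simp

lemma category_underlying: "category (underlying_cat M)"
  by unfold_locales
    (simp_all add: underlying_cat_def eid_in ecomp_in ecomp_single_assoc)

end

text \<open>The data (P, p, u) make P an n-th power of X for purely equational reasons, so that they are
  preserved by every enriched functor.\<close>

definition equational_power ::
  "('o, 'a) fset_cat \<Rightarrow> nat \<Rightarrow> 'o \<Rightarrow> 'o \<Rightarrow> (nat \<Rightarrow> 'a) \<Rightarrow> 'a \<Rightarrow> bool" where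
  "equational_power M n X P p u \<longleftrightarrow>
     X \<in> eobj M \<and> P \<in> eobj M \<and> p \<in> {..<n} \<rightarrow>\<^sub>E ehom M 1 P X \<and> u \<in> ehom M n X P \<and>
     (\<forall>i<n. ecomp M 1 n X P X (p i) (single u) = eproj M n X i) \<and>
     ecomp M n 1 P X P u p = eid M P"

locale fset_power = fset_category M
  for M :: "('o, 'a) fset_cat" and n X P p u +
  assumes equational_power: "equational_power M n X P p u"
begin

lemma base_in [simp]: "X \<in> eobj M"
  and power_in [simp]: "P \<in> eobj M"
  and proj_tuple_in [simp]: "p \<in> {..<n} \<rightarrow>\<^sub>E ehom M 1 P X"
  and unit_in [simp]: "u \<in> ehom M n X P"
  and proj_unit: "i < n \<Longrightarrow> ecomp M 1 n X P X (p i) (single u) = eproj M n X i"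
  and unit_proj: "ecomp M n 1 P X P u p = eid M P"
  using equational_power by (simp_all add: equational_power_def)

lemma proj_in [simp]: "i < n \<Longrightarrow> p i \<in> ehom M 1 P X"
  using proj_tuple_in by (rule PiE_mem) simp

lemma proj_tuple:
  assumes "W \<in> eobj M" "fs \<in> {..<n} \<rightarrow>\<^sub>E ehom M k W X" "i < n"
  shows "ecomp M 1 k W P X (p i) (single (ecomp M n k W X P u fs)) = fs i"
  using assms by (simp add: ecomp_single_assoc proj_unit proj_ecomp)

lemma unit_expand:
  assumes "W \<in> eobj M" "x \<in> ehom M k W P"
  shows "ecomp M n k W X P u (\<lambda>i\<in>{..<n}. ecomp M 1 k W P X (p i) (single x)) = x"
  using assms by (simp add: ecomp_assoc unit_proj)

text \<open>By \<open>unit_expand\<close> an element is rebuilt from its projections. The arity k is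
  arbitrary, whereas a power in the underlying category only separates unary elements.\<close>

lemma joint_monic:
  assumes "W \<in> eobj M" "x \<in> ehom M k W P" "y \<in> ehom M k W P"
    and "\<And>i. i < n \<Longrightarrow> ecomp M 1 k W P X (p i) (single x) = ecomp M 1 k W P X (p i) (single y)"
  shows "x = y"
proof -
  have "(\<lambda>i\<in>{..<n}. ecomp M 1 k W P X (p i) (single x))
      = (\<lambda>i\<in>{..<n}. ecomp M 1 k W P X (p i) (single y))"
    using assms by auto
  then show ?thesis
    using unit_expand[of W x] unit_expand[of W y] assms by metis
qed

text \<open>Associativity moves u inside, to the elements \<open>p\<^sub>i \<circ> u\<close>, and
  these are the projections.\<close>

lemma factor:
  assumes "Y \<in> eobj M" "f \<in> ehom M n X Y"
  shows "ecomp M 1 n X P Y (ecomp M n 1 P X Y f p) (single u) = f"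
proof -
  have "ecomp M 1 n X P Y (ecomp M n 1 P X Y f p) (single u)
      = ecomp M n n X X Y f (\<lambda>i\<in>{..<n}. ecomp M 1 n X P X (p i) (single u))"
    using assms by (intro ecomp_assoc[symmetric]) auto
  also have "\<dots> = f"
    using assms by (simp add: proj_unit ecomp_proj cong: restrict_cong)
  finally show ?thesis .
qed

text \<open>Composing u with a tuple of arrows into X gives the mediating arrow; its uniqueness is
  \<open>joint_monic\<close> at arity 1.\<close>

lemma is_power_underlying: "is_power (underlying_cat M) n X P p"
  unfolding is_power_def
proof (intro conjI ballI allI impI)
  fix Y f assume Y: "Y \<in> obj (underlying_cat M)" and f: "\<forall>i<n. f i \<in> hom (underlying_cat M) Y X"
  let ?h = "ecomp M n 1 Y X P u (restrict f {..<n})"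
  have h: "?h \<in> ehom M 1 Y P"
    using Y f by (intro ecomp_in) (auto simp: underlying_cat_def)
  have ph: "ecomp M 1 1 Y P X (p i) (single ?h) = f i" if "i < n" for i
    using Y f that by (subst proj_tuple) (auto simp: underlying_cat_def)
  show "\<exists>!h. h \<in> hom (underlying_cat M) Y P
      \<and> (\<forall>i<n. cmp (underlying_cat M) Y P X (p i) h = f i)"
  proof (rule ex1I[of _ ?h])
    fix g assume "g \<in> hom (underlying_cat M) Y P
      \<and> (\<forall>i<n. cmp (underlying_cat M) Y P X (p i) g = f i)"
    then have "g \<in> ehom M 1 Y P" "\<And>i. i < n \<Longrightarrow> ecomp M 1 1 Y P X (p i) (single g) = f i"
      by (auto simp: underlying_cat_def)
    then show "g = ?h"
      using Y by (intro joint_monic[OF _ _ h]) (simp_all only: ph, simp add: underlying_cat_def)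
  qed (use h ph in \<open>simp add: underlying_cat_def\<close>)
qed (simp_all add: underlying_cat_def)

text \<open>The universal element is carried along the comparison arrow g from P to Q. Then
  \<open>q\<^sub>i \<circ> (v \<circ> q) = \<pi>\<^sub>i \<circ> q = q\<^sub>i\<close>, so
  \<open>v \<circ> q\<close> is the identity by uniqueness of arrows into Q. This frees later
  arguments from a particular choice of power.\<close>

lemma equational_power_transport:
  assumes q: "is_power (underlying_cat M) n X Q q"
  shows "\<exists>v. equational_power M n X Q (restrict q {..<n}) v"
proof -
  let ?V = "underlying_cat M"
  have Q [simp]: "Q \<in> eobj M" and q_in [simp]: "i < n \<Longrightarrow> q i \<in> ehom M 1 Q X" for i
    using q by (auto simp: is_power_def underlying_cat_def)
  have uniq: "\<exists>!h. h \<in> ehom M 1 Y Q \<and> (\<forall>i<n. ecomp M 1 1 Y Q X (q i) (single h) = f i)"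
    if "Y \<in> eobj M" "\<And>i. i < n \<Longrightarrow> f i \<in> ehom M 1 Y X" for Y f
    using q that by (auto simp: is_power_def underlying_cat_def)
  obtain g where g [simp]: "g \<in> ehom M 1 P Q"
    and qg: "\<And>i. i < n \<Longrightarrow> ecomp M 1 1 P Q X (q i) (single g) = p i"
    using uniq[of P p] by auto
  let ?v = "ecomp M 1 n X P Q g (single u)"
  let ?w = "ecomp M n 1 Q X Q ?v (restrict q {..<n})"
  have v: "?v \<in> ehom M n X Q" by (simp add: ecomp_in)
  have qv: "ecomp M 1 n X Q X (q i) (single ?v) = eproj M n X i" if "i < n" for i
    using that by (simp add: ecomp_single_assoc qg proj_unit)
  have w: "?w \<in> ehom M 1 Q Q" using v by (intro ecomp_in) auto
  have "ecomp M 1 1 Q Q X (q i) (single ?w) = q i" if "i < n" for i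
    using that v by (subst ecomp_single_assoc) (auto simp: qv proj_ecomp)
  then have "?w \<in> ehom M 1 Q Q \<and> (\<forall>i<n. ecomp M 1 1 Q Q X (q i) (single ?w) = q i)"
    using w by blast
  moreover have "eid M Q \<in> ehom M 1 Q Q
      \<and> (\<forall>i<n. ecomp M 1 1 Q Q X (q i) (single (eid M Q)) = q i)"
    by (simp add: eid_in)
  moreover have "\<exists>!h. h \<in> ehom M 1 Q Q \<and> (\<forall>i<n. ecomp M 1 1 Q Q X (q i) (single h) = q i)"
    by (rule uniq) simp_all
  ultimately have "?w = eid M Q" by blast
  with v qv show ?thesis
    by (intro exI[of _ ?v]) (auto simp: equational_power_def)
qed

section \<open>Equational powers are the same as tensors\<close>

lemma inj_block_in: "j < k \<Longrightarrow> inj_block n j \<in> Fmap n (k * n)"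
proof (auto simp: inj_block_def)
  fix x assume "j < k" "x < n"
  then have "Suc j * n \<le> k * n" by (intro mult_le_mono1) simp
  with \<open>x < n\<close> show "j * n + x < k * n" by simp
qed

text \<open>The k copies of u and the kn elements \<open>?ps\<close> behave like mutually inverse
  matrices: composed either way they give the projections (\<open>up\<close> and \<open>pu\<close>).
  By associativity, composition with one family is then inverse to composition with the
  other.\<close>

lemma exhibits_tensor: "exhibits_tensor M n X P u"
  unfolding exhibits_tensor_def
proof (intro conjI ballI allI)
  fix Y k assume Y [simp]: "Y \<in> eobj M"
  let ?us = "\<lambda>j\<in>{..<k}. push M n (k * n) X P (inj_block n j) u"
  \<comment> \<open>An index \<open>l < k * n\<close> names position \<open>l mod n\<close> in block
    \<open>l div n\<close>; its entry is the projection \<open>p (l mod n)\<close> read in the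
    variable \<open>l div n\<close>.\<close>
  let ?ps = "\<lambda>l\<in>{..<k * n}. push M 1 k P X (single (l div n)) (p (l mod n))"
  have us: "?us \<in> {..<k} \<rightarrow>\<^sub>E ehom M (k * n) X P"
    by (auto intro!: push_in inj_block_in)
  \<comment> \<open>For n = 0 there is no l to consider, so \<open>l mod n < n\<close> holds in that
    case too.\<close>
  have lt: "l div n < k" "l mod n < n" if "l < k * n" for l
    using that
    by (simp_all add: less_mult_imp_div_less,
      metis mod_less_divisor mult_0_right not_gr_zero not_less_zero)
  have ps: "?ps \<in> {..<k * n} \<rightarrow>\<^sub>E ehom M k P X"
    using lt by (simp add: restrict_PiE_iff push_in)
  have idx: "inj_block n j i < k * n" "inj_block n j i div n = j" "inj_block n j i mod n = i"
    if "j < k" "i < n" for i j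
    using that PiE_mem[OF inj_block_in[of j k], of i] by (simp_all add: inj_block_def)
  \<comment> \<open>Naturality in the outer arity selects the entries of block j, all pushed along
    \<open>single j\<close>; naturality in the inner arity takes that map outside and leaves
    \<open>u \<circ> p = 1\<close>.\<close>
  have up: "ecomp M (k * n) k P X P (push M n (k * n) X P (inj_block n j) u) ?ps = eproj M k P j"
    if "j < k" for j
  proof -
    have "ecomp M (k * n) k P X P (push M n (k * n) X P (inj_block n j) u) ?ps
        = ecomp M n k P X P u (\<lambda>i\<in>{..<n}. ?ps (inj_block n j i))"
      using that ps by (intro ecomp_natural_outer inj_block_in) auto
    also have "\<dots> = ecomp M n k P X P u (\<lambda>i\<in>{..<n}. push M 1 k P X (single j) (p i))"
      using that by (simp add: idx cong: restrict_cong)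
    also have "\<dots> = push M 1 k P P (single j) (ecomp M n 1 P X P u p)"
      using that by (intro ecomp_natural_inner[symmetric]) auto
    finally show ?thesis by (simp add: unit_proj eproj_def)
  qed
  \<comment> \<open>Dually, the outer step selects the copy of u in block \<open>l div n\<close>.
    The inner step leaves \<open>p\<^sub>i \<circ> u\<close> for \<open>i = l mod n\<close>, a
    projection that the injection of the block sends to the l-th one.\<close>
  have pu: "ecomp M k (k * n) X P X (?ps l) ?us = eproj M (k * n) X l" if l: "l < k * n" for l
  proof -
    have "?ps l = push M 1 k P X (single (l div n)) (p (l mod n))"
      using l by simp
    then have "ecomp M k (k * n) X P X (?ps l) ?us
        = ecomp M k (k * n) X P X (push M 1 k P X (single (l div n)) (p (l mod n))) ?us"
      by (rule arg_cong)
    also have "\<dots> = ecomp M 1 (k * n) X P X (p (l mod n)) (\<lambda>i\<in>{..<1}. ?us (single (l div n) i))"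
      using l lt us by (intro ecomp_natural_outer) simp_all
    also have "\<dots> = ecomp M 1 (k * n) X P X (p (l mod n))
        (\<lambda>i\<in>{..<1}. push M n (k * n) X P (inj_block n (l div n)) (single u i))"
      using l lt by simp
    also have "\<dots> = push M n (k * n) X X (inj_block n (l div n))
        (ecomp M 1 n X P X (p (l mod n)) (single u))"
      using l lt by (intro ecomp_natural_inner[symmetric] inj_block_in) auto
    also have "\<dots> = eproj M (k * n) X l"
      using l lt by (simp add: proj_unit push_eproj inj_block_in) (simp add: inj_block_def)
    finally show ?thesis .
  qed
  show "bij_betw (\<lambda>g. ecomp M k (k * n) X P Y g ?us) (ehom M k P Y) (ehom M (k * n) X Y)"
  proof (rule bij_betw_byWitness[where f' = "\<lambda>f. ecomp M (k * n) k P X Y f ?ps"])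
    show "\<forall>g\<in>ehom M k P Y. ecomp M (k * n) k P X Y (ecomp M k (k * n) X P Y g ?us) ?ps = g"
    proof
      fix g assume g: "g \<in> ehom M k P Y"
      have "ecomp M (k * n) k P X Y (ecomp M k (k * n) X P Y g ?us) ?ps
          = ecomp M k k P P Y g (\<lambda>j\<in>{..<k}. ecomp M (k * n) k P X P (?us j) ?ps)"
        using g us ps by (intro ecomp_assoc[symmetric]) auto
      also have "\<dots> = g"
        using g by (simp add: up ecomp_proj cong: restrict_cong)
      finally show "ecomp M (k * n) k P X Y (ecomp M k (k * n) X P Y g ?us) ?ps = g" .
    qed
    show "\<forall>f\<in>ehom M (k * n) X Y. ecomp M k (k * n) X P Y (ecomp M (k * n) k P X Y f ?ps) ?us = f"
    proof
      fix f assume f: "f \<in> ehom M (k * n) X Y"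
      have "ecomp M k (k * n) X P Y (ecomp M (k * n) k P X Y f ?ps) ?us
          = ecomp M (k * n) (k * n) X X Y f (\<lambda>l\<in>{..<k * n}. ecomp M k (k * n) X P X (?ps l) ?us)"
        using f us ps by (intro ecomp_assoc[symmetric]) auto
      also have "\<dots> = ecomp M (k * n) (k * n) X X Y f (\<lambda>l\<in>{..<k * n}. eproj M (k * n) X l)"
        using pu by (simp cong: restrict_cong)
      also have "\<dots> = f"
        using f by (simp add: ecomp_proj)
      finally show "ecomp M k (k * n) X P Y (ecomp M (k * n) k P X Y f ?ps) ?us = f" .
    qed
  qed (intro image_subsetI ecomp_in us ps base_in power_in Y; assumption)+
qed simp

end

lemma (in fset_category) fset_powerI: "equational_power M n X P p u \<Longrightarrow> fset_power M n X P p u"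
  by unfold_locales

text \<open>The universal property with k = 1 and Y = X supplies \<open>p j\<close> as the preimage
  of the j-th projection. With Y = Z its injectivity reduces \<open>i \<circ> p = 1\<close> to
  \<open>(i \<circ> p) \<circ> i = i\<close>, which is associativity and the choice of p.\<close>

lemma (in fset_category) equational_power_if_tensor:
  assumes X [simp]: "X \<in> eobj M" and Z [simp]: "Z \<in> eobj M" and "exhibits_tensor M n X Z i"
  shows "\<exists>p. equational_power M n X Z p i"
proof -
  have i [simp]: "i \<in> ehom M n X Z" using assms by (simp add: exhibits_tensor_def)
  \<comment> \<open>For k = 1 the only injection \<open>inj_block n 0\<close> is the identity of n,
    so the push in the definition disappears.\<close>
  have push: "push M n n X Z (inj_block n 0) i = i"
    using push_id[of X Z i n] by (simp add: inj_block_def)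
  have bij: "bij_betw (\<lambda>g. ecomp M 1 n X Z Y g (single i)) (ehom M 1 Z Y) (ehom M n X Y)"
    if "Y \<in> eobj M" for Y
    using assms(3) that push unfolding exhibits_tensor_def
    by (auto dest!: bspec[of _ _ Y] spec[of _ 1])
  define p where "p = (\<lambda>j\<in>{..<n}.
    inv_into (ehom M 1 Z X) (\<lambda>g. ecomp M 1 n X Z X g (single i)) (eproj M n X j))"
  have p: "p \<in> {..<n} \<rightarrow>\<^sub>E ehom M 1 Z X"
    using bij_betw_imp_surj_on[OF bij[OF X]] unfolding p_def
    by (auto intro!: inv_into_into)
  have pi: "ecomp M 1 n X Z X (p j) (single i) = eproj M n X j" if "j < n" for j
    using bij_betw_inv_into_right[OF bij[OF X], of "eproj M n X j"] that by (simp add: p_def)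
  have "ecomp M 1 n X Z Z (ecomp M n 1 Z X Z i p) (single i)
      = ecomp M n n X X Z i (\<lambda>j\<in>{..<n}. ecomp M 1 n X Z X (p j) (single i))"
    using p by (intro ecomp_assoc[symmetric]) auto
  also have "\<dots> = ecomp M 1 n X Z Z (eid M Z) (single i)"
    by (simp add: pi ecomp_proj cong: restrict_cong)
  finally have "ecomp M n 1 Z X Z i p = eid M Z"
    using bij_betw_imp_inj_on[OF bij[OF Z]] p by (auto simp: inj_on_def ecomp_in eid_in)
  with p pi show ?thesis by (auto simp: equational_power_def)
qed

lemma (in fset_category) representable_iff:
  "representable M \<longleftrightarrow> (\<forall>X\<in>eobj M. \<forall>n. \<exists>P p u. equational_power M n X P p u)"
proof
  assume "representable M"
  then show "\<forall>X\<in>eobj M. \<forall>n. \<exists>P p u. equational_power M n X P p u"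
    unfolding representable_def using equational_power_if_tensor by metis
next
  assume *: "\<forall>X\<in>eobj M. \<forall>n. \<exists>P p u. equational_power M n X P p u"
  show "representable M"
    unfolding representable_def
  proof (intro ballI allI)
    fix X n assume "X \<in> eobj M"
    then obtain P p u where "equational_power M n X P p u" using * by blast
    then interpret fset_power M n X P p u by (rule fset_powerI)
    show "\<exists>Z\<in>eobj M. \<exists>i. exhibits_tensor M n X Z i"
      using exhibits_tensor power_in by blast
  qed
qed

section \<open>Enriched functors and transformations from unary data\<close>

lemma fset_functor_ext_eqI:
  assumes "fset_functor_ext M F" "fset_functor_ext M G"
    and "\<And>X. X \<in> eobj M \<Longrightarrow> efobj F X = efobj G X"
    and "\<And>n X Y f. \<lbrakk>X \<in> eobj M; Y \<in> eobj M; f \<in> ehom M n X Y\<rbrakk>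
      \<Longrightarrow> efarr F n X Y f = efarr G n X Y f"
  shows "F = G"
proof -
  have "efobj F = efobj G"
    using assms by (intro extensionalityI[of _ "eobj M"]) (auto simp: fset_functor_ext_def)
  moreover have "efarr F = efarr G"
    using assms unfolding fset_functor_ext_def by (intro ext) metis
  ultimately show ?thesis by simp
qed

lemma fset_functor_ext_id: "fset_functor_ext M (id_fset_functor M)"
  by (simp add: fset_functor_ext_def id_fset_functor_def)

lemma fset_functor_ext_comp: "fset_functor_ext M (comp_fset_functor M G F)"
  by (simp add: fset_functor_ext_def comp_fset_functor_def)

lemma fset_functor_id:
  assumes "fset_category M"
  shows "fset_functor M M (id_fset_functor M)"
proof -
  interpret fset_category M by fact
  show ?thesis
  proof
    fix X Y Z g m fs n
    assume *: "X \<in> eobj M" "Y \<in> eobj M" "Z \<in> eobj M" "g \<in> ehom M m Y Z"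
      "fs \<in> {..<m} \<rightarrow>\<^sub>E ehom M n X Y"
    then have "(\<lambda>i\<in>{..<m}. efarr (id_fset_functor M) n X Y (fs i)) = fs"
      by (intro extensionalityI[of _ "{..<m}"]) (auto simp: id_fset_functor_def PiE_iff)
    with * show "efarr (id_fset_functor M) n X Z (ecomp M m n X Y Z g fs)
        = ecomp M m n (efobj (id_fset_functor M) X) (efobj (id_fset_functor M) Y)
          (efobj (id_fset_functor M) Z) (efarr (id_fset_functor M) m Y Z g)
          (\<lambda>i\<in>{..<m}. efarr (id_fset_functor M) n X Y (fs i))"
      by (simp add: id_fset_functor_def ecomp_in)
  qed (simp_all add: id_fset_functor_def push_in eid_in)
qed

lemma fset_functor_comp:
  assumes "fset_category L" "fset_functor L M F" "fset_functor M N G"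
  shows "fset_functor L N (comp_fset_functor L G F)"
proof -
  interpret L: fset_category L by fact
  interpret F: fset_functor L M F by fact
  interpret G: fset_functor M N G by fact
  show ?thesis
  proof
    fix X Y Z g m fs n
    assume *: "X \<in> eobj L" "Y \<in> eobj L" "Z \<in> eobj L" "g \<in> ehom L m Y Z"
      "fs \<in> {..<m} \<rightarrow>\<^sub>E ehom L n X Y"
    have "fs i \<in> ehom L n X Y" if "i < m" for i
      using * that by auto
    then have "(\<lambda>i\<in>{..<m}. efarr F n X Y (fs i)) \<in> {..<m} \<rightarrow>\<^sub>E ehom M n (efobj F X) (efobj F Y)"
      "(\<lambda>i\<in>{..<m}. efarr (comp_fset_functor L G F) n X Y (fs i))
        = (\<lambda>i\<in>{..<m}. efarr G n (efobj F X) (efobj F Y) ((\<lambda>i\<in>{..<m}. efarr F n X Y (fs i)) i))"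
      using * by (auto simp: comp_fset_functor_def F.efarr_in intro!: restrict_ext)
    with * show "efarr (comp_fset_functor L G F) n X Z (ecomp L m n X Y Z g fs)
        = ecomp N m n (efobj (comp_fset_functor L G F) X) (efobj (comp_fset_functor L G F) Y)
          (efobj (comp_fset_functor L G F) Z) (efarr (comp_fset_functor L G F) m Y Z g)
          (\<lambda>i\<in>{..<m}. efarr (comp_fset_functor L G F) n X Y (fs i))"
      by (simp only:) (simp add: comp_fset_functor_def L.ecomp_in F.efobj_in F.efarr_in
          F.efarr_ecomp G.efarr_ecomp)
  qed (simp_all add: comp_fset_functor_def L.push_in L.eid_in F.efobj_in F.efarr_in F.efarr_push
      F.efarr_eid G.efobj_in G.efarr_in G.efarr_push G.efarr_eid)
qed

lemma (in fset_functor) efarr_single_ecomp: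
  assumes "X \<in> eobj M" "Y \<in> eobj M" "Z \<in> eobj M" "g \<in> ehom M 1 Y Z" "f \<in> ehom M n X Y"
  shows "efarr F n X Z (ecomp M 1 n X Y Z g (single f))
    = ecomp N 1 n (efobj F X) (efobj F Y) (efobj F Z) (efarr F 1 Y Z g) (single (efarr F n X Y f))"
  using efarr_ecomp[of X Y Z g 1 "single f" n] assms by simp

lemma (in fset_functor) is_functor_underlying:
  "is_functor (underlying_cat M) (underlying_cat N) (underlying_functor F)"
  by unfold_locales
    (simp_all add: underlying_cat_def underlying_functor_def efobj_in efarr_in efarr_eid
      efarr_single_ecomp)

lemma functor_ext_underlying:
  "fset_functor_ext M F \<Longrightarrow> functor_ext (underlying_cat M) (underlying_functor F)"
  by (simp add: functor_ext_def fset_functor_ext_def underlying_cat_def underlying_functor_def)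

lemma underlying_functor_id: "underlying_functor (id_fset_functor M) = id_functor (underlying_cat M)"
  by (simp add: underlying_functor_def id_functor_def id_fset_functor_def underlying_cat_def)

lemma underlying_functor_comp:
  "underlying_functor (comp_fset_functor L G F)
    = comp_functor (underlying_cat L) (underlying_functor G) (underlying_functor F)"
  by (simp add: underlying_functor_def comp_functor_def comp_fset_functor_def underlying_cat_def
      cong: if_cong)

section \<open>Enriched functors and transformations between representable categories\<close>

locale fset_functor_between = M: fset_category M + N: fset_category N + fset_functor M N F
  for M :: "('o, 'a) fset_cat" and N :: "('p, 'b) fset_cat" and F
begin

lemma efarr_eproj:
  assumes "X \<in> eobj M" "i < n"
  shows "efarr F n X X (eproj M n X i) = eproj N n (efobj F X) i"
  using assms by (simp add: eproj_def efarr_push M.eid_in efarr_eid)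

lemma equational_power_map:
  assumes "equational_power M n X P p u"
  shows "equational_power N n (efobj F X) (efobj F P) (\<lambda>i\<in>{..<n}. efarr F 1 P X (p i))
    (efarr F n X P u)"
proof -
  interpret fset_power M n X P p u using assms by (rule M.fset_powerI)
  have "ecomp N n 1 (efobj F P) (efobj F X) (efobj F P) (efarr F n X P u)
      (\<lambda>i\<in>{..<n}. efarr F 1 P X (p i)) = eid N (efobj F P)"
    using efarr_ecomp[of P X P u n p 1] by (simp add: unit_proj efarr_eid)
  then show ?thesis
    by (auto simp: equational_power_def efobj_in efarr_in efarr_single_ecomp[symmetric]
        proj_unit efarr_eproj)
qed

text \<open>A power in the underlying category comes without a universal element.
  \<open>equational_power_transport\<close> supplies one, F maps the resulting equations, and
  \<open>is_power_underlying\<close> reads the power off again.\<close>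

lemma preserves_finite_powers_underlying:
  assumes "representable M"
  shows "preserves_finite_powers (underlying_cat M) (underlying_cat N) (underlying_functor F)"
  unfolding preserves_finite_powers_def
proof (intro ballI allI impI)
  fix X n Q q assume "X \<in> obj (underlying_cat M)" and q: "is_power (underlying_cat M) n X Q q"
  then have "X \<in> eobj M" by (simp add: underlying_cat_def)
  then obtain P p u where "equational_power M n X P p u"
    using assms M.representable_iff by blast
  then interpret fset_power M n X P p u by (rule M.fset_powerI)
  obtain v where "equational_power M n X Q (restrict q {..<n}) v"
    using equational_power_transport[OF q] by blast
  then have "equational_power N n (efobj F X) (efobj F Q)
      (\<lambda>i\<in>{..<n}. efarr F 1 Q X (restrict q {..<n} i)) (efarr F n X Q v)"
    by (rule equational_power_map)
  then have "is_power (underlying_cat N) n (efobj F X) (efobj F Q)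
      (\<lambda>i\<in>{..<n}. efarr F 1 Q X (restrict q {..<n} i))"
    by (intro fset_power.is_power_underlying N.fset_powerI)
  then show "is_power (underlying_cat N) n (fobj (underlying_functor F) X)
      (fobj (underlying_functor F) Q) (\<lambda>i. farr (underlying_functor F) Q X (q i))"
    by (subst (asm) is_power_cong[where q = "\<lambda>i. efarr F 1 Q X (q i)"])
      (simp_all add: underlying_functor_def)
qed

end

text \<open>Every f is \<open>(f \<circ> p) \<circ> u\<close> with \<open>f \<circ> p\<close> unary,
  so only the images of u are in doubt.\<close>

lemma underlying_functor_inject:
  fixes M :: "('o, 'a) fset_cat" and N :: "('p, 'b) fset_cat"
  assumes "fset_category M" "fset_category N" "representable M"
    and "fset_functor M N F" "fset_functor M N G" "fset_functor_ext M F" "fset_functor_ext M G"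
    and eq: "underlying_functor F = underlying_functor G"
  shows "F = G"
proof (rule fset_functor_ext_eqI)
  interpret M: fset_category M by fact
  interpret N: fset_category N by fact
  interpret F: fset_functor_between M N F by (intro fset_functor_between.intro assms)
  interpret G: fset_functor_between M N G by (intro fset_functor_between.intro assms)
  have obj: "efobj F = efobj G" and arr: "efarr F 1 = efarr G 1"
    using eq by (simp_all add: underlying_functor_def)
  show "efobj F X = efobj G X" for X by (simp add: obj)
  fix n X Y f assume X: "X \<in> eobj M" and Y: "Y \<in> eobj M" and f: "f \<in> ehom M n X Y"
  obtain P p u where P: "equational_power M n X P p u"
    using X \<open>representable M\<close> M.representable_iff by blast
  interpret P: fset_power M n X P p u using P by (rule M.fset_powerI)
  interpret FP: fset_power N n "efobj F X" "efobj F P" "\<lambda>i\<in>{..<n}. efarr F 1 P X (p i)"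
    "efarr F n X P u"
    using F.equational_power_map[OF P] by (rule N.fset_powerI)
  \<comment> \<open>F and G agree on objects and unary arrows, so both images of u are universal
    elements for the same object and projections; joint monicity identifies them.\<close>
  interpret GP: fset_power N n "efobj F X" "efobj F P" "\<lambda>i\<in>{..<n}. efarr F 1 P X (p i)"
    "efarr G n X P u"
    using G.equational_power_map[OF P] unfolding obj arr by (rule N.fset_powerI)
  have u: "efarr F n X P u = efarr G n X P u"
    by (rule FP.joint_monic[OF FP.base_in FP.unit_in GP.unit_in])
      (simp only: FP.proj_unit GP.proj_unit)
  have "efarr F n X Y f = efarr F n X Y (ecomp M 1 n X P Y (ecomp M n 1 P X Y f p) (single u))"
    using Y f by (simp add: P.factor)
  also have "\<dots> = efarr G n X Y (ecomp M 1 n X P Y (ecomp M n 1 P X Y f p) (single u))"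
    using Y f by (simp add: F.efarr_single_ecomp G.efarr_single_ecomp M.ecomp_in obj arr u)
  also have "\<dots> = efarr G n X Y f"
    using Y f by (simp add: P.factor)
  finally show "efarr F n X Y f = efarr G n X Y f" .
qed fact+

text \<open>For the converse write f as \<open>f' \<circ> u\<close> with \<open>f'\<close> unary.
  Naturality at \<open>f'\<close> is given, and naturality at u follows from the universal property
  of the power \<open>efobj G P\<close>.\<close>

lemma fset_trans_iff:
  fixes M :: "('o, 'a) fset_cat" and N :: "('p, 'b) fset_cat"
  assumes "fset_category M" "fset_category N" "representable M"
    and "fset_functor M N F" "fset_functor M N G"
  shows "fset_trans M N F G \<alpha> \<longleftrightarrow>
    nat_trans (underlying_cat M) (underlying_cat N) (underlying_functor F) (underlying_functor G) \<alpha>"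
    (is "_ = nat_trans ?VM ?VN ?VF ?VG \<alpha>")
proof -
  interpret M: fset_category M by fact
  interpret N: fset_category N by fact
  interpret F: fset_functor_between M N F by (intro fset_functor_between.intro assms)
  interpret G: fset_functor_between M N G by (intro fset_functor_between.intro assms)
  note [simp] = F.efobj_in F.efarr_in G.efobj_in G.efarr_in
  show ?thesis
  proof
    assume "fset_trans M N F G \<alpha>"
    then interpret fset_trans M N F G \<alpha> .
    show "nat_trans ?VM ?VN ?VF ?VG \<alpha>"
    proof
      fix X Y f assume "X \<in> obj ?VM" "Y \<in> obj ?VM" "f \<in> hom ?VM X Y"
      then show "cmp ?VN (fobj ?VF X) (fobj ?VF Y) (fobj ?VG Y) (\<alpha> Y) (farr ?VF X Y f)
          = cmp ?VN (fobj ?VF X) (fobj ?VG X) (fobj ?VG Y) (farr ?VG X Y f) (\<alpha> X)"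
        using naturality[of X Y f 1]
        by (simp add: underlying_cat_def underlying_functor_def component_in)
    qed (simp add: underlying_cat_def underlying_functor_def component_in)
  next
    assume "nat_trans ?VM ?VN ?VF ?VG \<alpha>"
    then interpret nat_trans ?VM ?VN ?VF ?VG \<alpha> .
    have comp [simp]: "X \<in> eobj M \<Longrightarrow> \<alpha> X \<in> ehom N 1 (efobj F X) (efobj G X)" for X
      using component_in by (simp add: underlying_cat_def underlying_functor_def)
    have nat: "ecomp N 1 1 (efobj F X) (efobj F Y) (efobj G Y) (\<alpha> Y) (single (efarr F 1 X Y f))
        = ecomp N 1 1 (efobj F X) (efobj G X) (efobj G Y) (efarr G 1 X Y f) (single (\<alpha> X))"
      if "X \<in> eobj M" "Y \<in> eobj M" "f \<in> ehom M 1 X Y" for X Y f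
      using naturality[of X Y f] that by (simp add: underlying_cat_def underlying_functor_def)
    show "fset_trans M N F G \<alpha>"
    proof
      fix X Y f n assume X [simp]: "X \<in> eobj M" and Y [simp]: "Y \<in> eobj M"
        and f: "f \<in> ehom M n X Y"
      obtain P p u where P: "equational_power M n X P p u"
        using X \<open>representable M\<close> M.representable_iff by blast
      interpret P: fset_power M n X P p u using P by (rule M.fset_powerI)
      interpret GP: fset_power N n "efobj G X" "efobj G P" "\<lambda>i\<in>{..<n}. efarr G 1 P X (p i)"
        "efarr G n X P u"
        using G.equational_power_map[OF P] by (rule N.fset_powerI)
      let ?f = "ecomp M n 1 P X Y f p"
      let ?as = "\<lambda>i\<in>{..<n}. ecomp N 1 n (efobj F X) (efobj F X) (efobj G X) (\<alpha> X)
        (single (eproj N n (efobj F X) i))"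
      have f' [simp]: "?f \<in> ehom M 1 P Y" using f by (simp add: M.ecomp_in)
      have as: "?as \<in> {..<n} \<rightarrow>\<^sub>E ehom N n (efobj F X) (efobj G X)"
        by (simp add: restrict_PiE_iff N.ecomp_in)
      \<comment> \<open>The two sides are tested against the projections of
        \<open>efobj G P\<close>: by naturality at the unary \<open>p i\<close>, both become
        \<open>\<alpha> X\<close> composed with the i-th projection.\<close>
      have unit: "ecomp N 1 n (efobj F X) (efobj F P) (efobj G P) (\<alpha> P) (single (efarr F n X P u))
          = ecomp N n n (efobj F X) (efobj G X) (efobj G P) (efarr G n X P u) ?as" (is "?l = ?r")
      proof (rule GP.joint_monic[of "efobj F X"])
        fix i assume i: "i < n"
        have "ecomp N 1 n (efobj F X) (efobj G P) (efobj G X) (efarr G 1 P X (p i)) (single ?l)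
            = ecomp N 1 n (efobj F X) (efobj F P) (efobj G X)
              (ecomp N 1 1 (efobj F P) (efobj F X) (efobj G X) (\<alpha> X) (single (efarr F 1 P X (p i))))
              (single (efarr F n X P u))"
          using i by (simp add: N.ecomp_single_assoc nat)
        also have "\<dots> = ?as i"
          using i by (simp add: N.ecomp_single_assoc[symmetric] F.efarr_single_ecomp[symmetric]
              P.proj_unit F.efarr_eproj)
        finally show "ecomp N 1 n (efobj F X) (efobj G P) (efobj G X)
              ((\<lambda>i\<in>{..<n}. efarr G 1 P X (p i)) i) (single ?l)
            = ecomp N 1 n (efobj F X) (efobj G P) (efobj G X)
              ((\<lambda>i\<in>{..<n}. efarr G 1 P X (p i)) i) (single ?r)"
          using i as GP.proj_tuple[of "efobj F X" ?as n i] by simp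
      qed (use as in \<open>simp_all add: N.ecomp_in\<close>)
      have "ecomp N 1 n (efobj F X) (efobj F Y) (efobj G Y) (\<alpha> Y) (single (efarr F n X Y f))
          = ecomp N 1 n (efobj F X) (efobj F Y) (efobj G Y) (\<alpha> Y)
            (single (efarr F n X Y (ecomp M 1 n X P Y ?f (single u))))"
        using f by (simp add: P.factor)
      also have "\<dots> = ecomp N 1 n (efobj F X) (efobj G P) (efobj G Y) (efarr G 1 P Y ?f) (single ?l)"
        by (simp add: F.efarr_single_ecomp N.ecomp_single_assoc nat)
      also have "\<dots> = ecomp N n n (efobj F X) (efobj G X) (efobj G Y)
          (efarr G n X Y (ecomp M 1 n X P Y ?f (single u))) ?as"
        unfolding unit using as by (simp add: G.efarr_single_ecomp N.ecomp_single_assoc)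
      also have "\<dots> = ecomp N n n (efobj F X) (efobj G X) (efobj G Y) (efarr G n X Y f) ?as"
        using f by (simp add: P.factor)
      finally show "ecomp N 1 n (efobj F X) (efobj F Y) (efobj G Y) (\<alpha> Y)
          (single (efarr F n X Y f))
        = ecomp N n n (efobj F X) (efobj G X) (efobj G Y) (efarr G n X Y f) ?as" .
    qed simp
  qed
qed

section \<open>Extension of a power-preserving functor to all arities\<close>

locale fset_functor_lift = M: fset_category M + N: fset_category N +
  is_functor "underlying_cat M" "underlying_cat N" K
  for M :: "('o, 'a) fset_cat" and N :: "('p, 'b) fset_cat" and K +
  fixes P p u v
  assumes source_power: "X \<in> eobj M \<Longrightarrow> equational_power M n X (P n X) (p n X) (u n X)"
    and target_power: "X \<in> eobj M \<Longrightarrow> equational_power N n (fobj K X) (fobj K (P n X))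
      (\<lambda>i\<in>{..<n}. farr K (P n X) X (p n X i)) (v n X)"
begin

lemma K_obj [simp]: "X \<in> eobj M \<Longrightarrow> fobj K X \<in> eobj N"
  using fobj_in by (simp add: underlying_cat_def)

lemma K_arr [simp]:
  "\<lbrakk>X \<in> eobj M; Y \<in> eobj M; f \<in> ehom M 1 X Y\<rbrakk> \<Longrightarrow> farr K X Y f \<in> ehom N 1 (fobj K X) (fobj K Y)"
  using farr_in by (simp add: underlying_cat_def)

lemma K_cmp:
  "\<lbrakk>X \<in> eobj M; Y \<in> eobj M; Z \<in> eobj M; g \<in> ehom M 1 Y Z; f \<in> ehom M 1 X Y\<rbrakk>
    \<Longrightarrow> farr K X Z (ecomp M 1 1 X Y Z g (single f))
      = ecomp N 1 1 (fobj K X) (fobj K Y) (fobj K Z) (farr K Y Z g) (single (farr K X Y f))"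
  using farr_cmp by (simp add: underlying_cat_def)

definition lift_arr :: "nat \<Rightarrow> 'o \<Rightarrow> 'o \<Rightarrow> 'a \<Rightarrow> 'b" where
  "lift_arr n X Y f = ecomp N 1 n (fobj K X) (fobj K (P n X)) (fobj K Y)
     (farr K (P n X) Y (ecomp M n 1 (P n X) X Y f (p n X))) (single (v n X))"

lemma lift_arr_in [simp]:
  assumes X: "X \<in> eobj M" and "Y \<in> eobj M" "f \<in> ehom M n X Y"
  shows "lift_arr n X Y f \<in> ehom N n (fobj K X) (fobj K Y)"
proof -
  interpret P: fset_power M n X "P n X" "p n X" "u n X"
    using source_power[OF X] by (rule M.fset_powerI)
  interpret Q: fset_power N n "fobj K X" "fobj K (P n X)"
    "\<lambda>i\<in>{..<n}. farr K (P n X) X (p n X i)" "v n X"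
    using target_power[OF X] by (rule N.fset_powerI)
  show ?thesis using assms by (simp add: lift_arr_def N.ecomp_in M.ecomp_in)
qed

text \<open>Composing with a unary g on the left commutes with composing with p on the right, and K
  respects unary composites. General composites are reduced to this case.\<close>

lemma lift_arr_single_ecomp:
  assumes X: "X \<in> eobj M" and YZ: "Y \<in> eobj M" "Z \<in> eobj M"
    and gf: "g \<in> ehom M 1 Y Z" "f \<in> ehom M n X Y"
  shows "lift_arr n X Z (ecomp M 1 n X Y Z g (single f))
    = ecomp N 1 n (fobj K X) (fobj K Y) (fobj K Z) (farr K Y Z g) (single (lift_arr n X Y f))"
proof -
  interpret P: fset_power M n X "P n X" "p n X" "u n X"
    using source_power[OF X] by (rule M.fset_powerI)
  interpret Q: fset_power N n "fobj K X" "fobj K (P n X)"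
    "\<lambda>i\<in>{..<n}. farr K (P n X) X (p n X i)" "v n X"
    using target_power[OF X] by (rule N.fset_powerI)
  have "ecomp M n 1 (P n X) X Z (ecomp M 1 n X Y Z g (single f)) (p n X)
      = ecomp M 1 1 (P n X) Y Z g (single (ecomp M n 1 (P n X) X Y f (p n X)))"
    using assms by (simp add: M.ecomp_single_assoc)
  then show ?thesis
    using assms by (simp add: lift_arr_def K_cmp M.ecomp_in N.ecomp_single_assoc)
qed

text \<open>Composing \<open>\<pi>\<^sub>i\<close> with p gives \<open>p\<^sub>i\<close>, and v is
  universal for the images of the \<open>p\<^sub>i\<close> under K.\<close>

lemma lift_arr_eproj:
  assumes X: "X \<in> eobj M" and i: "i < n"
  shows "lift_arr n X X (eproj M n X i) = eproj N n (fobj K X) i"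
proof -
  interpret P: fset_power M n X "P n X" "p n X" "u n X"
    using source_power[OF X] by (rule M.fset_powerI)
  interpret Q: fset_power N n "fobj K X" "fobj K (P n X)"
    "\<lambda>i\<in>{..<n}. farr K (P n X) X (p n X i)" "v n X"
    using target_power[OF X] by (rule N.fset_powerI)
  show ?thesis
    using Q.proj_unit[OF i] i by (simp add: lift_arr_def M.proj_ecomp)
qed

lemma lift_arr_eid: "X \<in> eobj M \<Longrightarrow> lift_arr 1 X X (eid M X) = eid N (fobj K X)"
  using lift_arr_eproj[of X 0 1] by simp

text \<open>The chosen first power \<open>P 1 X\<close> may differ from X, so the definition does
  not give this directly; write f as \<open>f \<circ> 1\<close> and use
  \<open>lift_arr_eid\<close>.\<close>

lemma lift_arr_1:
  assumes "X \<in> eobj M" "Y \<in> eobj M" "f \<in> ehom M 1 X Y"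
  shows "lift_arr 1 X Y f = farr K X Y f"
  using lift_arr_single_ecomp[of X X Y f "eid M X" 1] assms by (simp add: lift_arr_eid M.eid_in)

text \<open>Factor g as \<open>?g \<circ> u\<close> with \<open>?g\<close> unary. The composite
  becomes \<open>?g\<close> after the single element \<open>?h\<close>, where the unary case
  applies, and the lift of \<open>?h\<close> is determined by its projections, the lifts of the
  \<open>fs i\<close>.\<close>

lemma lift_arr_ecomp:
  assumes X: "X \<in> eobj M" and Y: "Y \<in> eobj M" and Z: "Z \<in> eobj M"
    and g: "g \<in> ehom M m Y Z" and fs: "fs \<in> {..<m} \<rightarrow>\<^sub>E ehom M n X Y"
  shows "lift_arr n X Z (ecomp M m n X Y Z g fs)
    = ecomp N m n (fobj K X) (fobj K Y) (fobj K Z) (lift_arr m Y Z g)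
      (\<lambda>i\<in>{..<m}. lift_arr n X Y (fs i))"
proof -
  interpret P: fset_power M m Y "P m Y" "p m Y" "u m Y"
    using source_power[OF Y] by (rule M.fset_powerI)
  interpret Q: fset_power N m "fobj K Y" "fobj K (P m Y)"
    "\<lambda>i\<in>{..<m}. farr K (P m Y) Y (p m Y i)" "v m Y"
    using target_power[OF Y] by (rule N.fset_powerI)
  let ?g = "ecomp M m 1 (P m Y) Y Z g (p m Y)"
  let ?h = "ecomp M m n X Y (P m Y) (u m Y) fs"
  let ?Fs = "\<lambda>i\<in>{..<m}. lift_arr n X Y (fs i)"
  have g' [simp]: "?g \<in> ehom M 1 (P m Y) Z" using Z g by (simp add: M.ecomp_in)
  have h [simp]: "?h \<in> ehom M n X (P m Y)" using X fs by (simp add: M.ecomp_in)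
  have fs_i [simp]: "fs i \<in> ehom M n X Y" if "i < m" for i using fs that by auto
  have Fs: "?Fs \<in> {..<m} \<rightarrow>\<^sub>E ehom N n (fobj K X) (fobj K Y)"
    using X Y by (simp add: restrict_PiE_iff)
  have h_eq: "lift_arr n X (P m Y) ?h
      = ecomp N m n (fobj K X) (fobj K Y) (fobj K (P m Y)) (v m Y) ?Fs"
  proof (rule Q.joint_monic[of "fobj K X"])
    fix i assume i: "i < m"
    have "ecomp N 1 n (fobj K X) (fobj K (P m Y)) (fobj K Y) (farr K (P m Y) Y (p m Y i))
          (single (lift_arr n X (P m Y) ?h))
        = lift_arr n X Y (ecomp M 1 n X (P m Y) Y (p m Y i) (single ?h))"
      using X i by (simp add: lift_arr_single_ecomp)
    also have "\<dots> = ?Fs i"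
      using X fs i by (simp add: P.proj_tuple)
    finally show "ecomp N 1 n (fobj K X) (fobj K (P m Y)) (fobj K Y)
          ((\<lambda>i\<in>{..<m}. farr K (P m Y) Y (p m Y i)) i) (single (lift_arr n X (P m Y) ?h))
        = ecomp N 1 n (fobj K X) (fobj K (P m Y)) (fobj K Y)
          ((\<lambda>i\<in>{..<m}. farr K (P m Y) Y (p m Y i)) i)
          (single (ecomp N m n (fobj K X) (fobj K Y) (fobj K (P m Y)) (v m Y) ?Fs))"
      using Q.proj_tuple[OF _ Fs i] X i by simp
  qed (use X Fs in \<open>simp_all add: N.ecomp_in\<close>)
  have "lift_arr n X Z (ecomp M m n X Y Z g fs)
      = lift_arr n X Z (ecomp M m n X Y Z (ecomp M 1 m Y (P m Y) Z ?g (single (u m Y))) fs)"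
    using Z g by (simp add: P.factor)
  also have "\<dots> = lift_arr n X Z (ecomp M 1 n X (P m Y) Z ?g (single ?h))"
    using X Z fs by (simp add: M.ecomp_single_assoc)
  also have "\<dots> = ecomp N 1 n (fobj K X) (fobj K (P m Y)) (fobj K Z) (farr K (P m Y) Z ?g)
      (single (ecomp N m n (fobj K X) (fobj K Y) (fobj K (P m Y)) (v m Y) ?Fs))"
    using X Z by (simp add: lift_arr_single_ecomp h_eq)
  also have "\<dots> = ecomp N m n (fobj K X) (fobj K Y) (fobj K Z) (lift_arr m Y Z g) ?Fs"
    using X Z Fs by (simp add: N.ecomp_single_assoc lift_arr_def)
  finally show ?thesis .
qed

text \<open>By \<open>push_eq_ecomp\<close> the action is composition with projections, and the lift
  respects both composites and projections.\<close>

lemma lift_arr_push: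
  assumes "X \<in> eobj M" "Y \<in> eobj M" "\<phi> \<in> Fmap n m" "f \<in> ehom M n X Y"
  shows "lift_arr m X Y (push M n m X Y \<phi> f)
    = push N n m (fobj K X) (fobj K Y) \<phi> (lift_arr n X Y f)"
proof -
  have \<phi>: "\<phi> i < m" if "i < n" for i using assms(3) that by auto
  then show ?thesis
    using assms
    by (simp add: M.push_eq_ecomp N.push_eq_ecomp lift_arr_ecomp restrict_PiE_iff lift_arr_eproj
        cong: restrict_cong)
qed

definition lift_functor :: "('o, 'a, 'p, 'b) fset_fun" where
  "lift_functor = \<lparr>efobj = fobj K,
     efarr = (\<lambda>n X Y f. if X \<in> eobj M \<and> Y \<in> eobj M \<and> f \<in> ehom M n X Y
       then lift_arr n X Y f else undefined)\<rparr>"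

lemma fset_functor_lift: "fset_functor M N lift_functor"
proof
  fix X Y Z g m fs n
  assume *: "X \<in> eobj M" "Y \<in> eobj M" "Z \<in> eobj M" "g \<in> ehom M m Y Z"
    "fs \<in> {..<m} \<rightarrow>\<^sub>E ehom M n X Y"
  moreover from this have "(\<lambda>i\<in>{..<m}. efarr lift_functor n X Y (fs i))
      = (\<lambda>i\<in>{..<m}. lift_arr n X Y (fs i))"
    by (intro restrict_ext) (auto simp: lift_functor_def)
  ultimately show "efarr lift_functor n X Z (ecomp M m n X Y Z g fs)
      = ecomp N m n (efobj lift_functor X) (efobj lift_functor Y) (efobj lift_functor Z)
        (efarr lift_functor m Y Z g) (\<lambda>i\<in>{..<m}. efarr lift_functor n X Y (fs i))"
    by (simp only:) (simp add: lift_functor_def M.ecomp_in lift_arr_ecomp)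
qed (simp_all add: lift_functor_def M.push_in M.eid_in lift_arr_push lift_arr_eid)

lemma lift_functor_ext:
  "functor_ext (underlying_cat M) K \<Longrightarrow> fset_functor_ext M lift_functor"
  by (simp add: functor_ext_def fset_functor_ext_def lift_functor_def underlying_cat_def)

lemma underlying_lift_functor:
  assumes "functor_ext (underlying_cat M) K"
  shows "underlying_functor lift_functor = K"
proof (rule functor_ext_eqI[OF functor_ext_underlying assms])
  show "fset_functor_ext M lift_functor" using assms by (rule lift_functor_ext)
qed (simp_all add: underlying_functor_def lift_functor_def underlying_cat_def lift_arr_1)

end

text \<open>K carries a power of X to a power of its image. Since N has some equational power of
  that image, \<open>equational_power_transport\<close> yields the universal element v that the
  extension needs.\<close>

lemma underlying_functor_surj:
  fixes M :: "('o, 'a) fset_cat" and N :: "('p, 'b) fset_cat"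
  assumes "fset_category M" "fset_category N" "representable M" "representable N"
    and "is_functor (underlying_cat M) (underlying_cat N) K" "functor_ext (underlying_cat M) K"
    and pres: "preserves_finite_powers (underlying_cat M) (underlying_cat N) K"
  shows "\<exists>F. fset_functor M N F \<and> fset_functor_ext M F \<and> underlying_functor F = K"
proof -
  interpret M: fset_category M by fact
  interpret N: fset_category N by fact
  interpret K: is_functor "underlying_cat M" "underlying_cat N" K by fact
  \<comment> \<open>The condition on X stands inside the existential, so that choice yields total
    functions of n and X.\<close>
  have "\<forall>n X. \<exists>P p u v. X \<in> eobj M \<longrightarrow> equational_power M n X P p u \<and>
      equational_power N n (fobj K X) (fobj K P) (\<lambda>i\<in>{..<n}. farr K P X (p i)) v"
  proof (intro allI)
    fix n X
    show "\<exists>P p u v. X \<in> eobj M \<longrightarrow> equational_power M n X P p u \<and>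
      equational_power N n (fobj K X) (fobj K P) (\<lambda>i\<in>{..<n}. farr K P X (p i)) v"
    proof (cases "X \<in> eobj M")
      case True
      then obtain P p u where P: "equational_power M n X P p u"
        using \<open>representable M\<close> M.representable_iff by blast
      interpret P: fset_power M n X P p u using P by (rule M.fset_powerI)
      have power: "is_power (underlying_cat N) n (fobj K X) (fobj K P) (\<lambda>i. farr K P X (p i))"
        using pres P.is_power_underlying True
        by (simp add: preserves_finite_powers_def underlying_cat_def)
      have "fobj K X \<in> eobj N" using K.fobj_in[of X] True by (simp add: underlying_cat_def)
      then obtain Q q w where "equational_power N n (fobj K X) Q q w"
        using \<open>representable N\<close> N.representable_iff by blast
      then interpret Q: fset_power N n "fobj K X" Q q w by (rule N.fset_powerI)
      show ?thesis using P Q.equational_power_transport[OF power] by blast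
    qed simp
  qed
  then obtain P p u v where "\<And>n X. X \<in> eobj M \<Longrightarrow> equational_power M n X (P n X) (p n X) (u n X) \<and>
      equational_power N n (fobj K X) (fobj K (P n X)) (\<lambda>i\<in>{..<n}. farr K (P n X) X (p n X i)) (v n X)"
    by metis
  then interpret fset_functor_lift M N K P p u v by unfold_locales blast+
  show ?thesis
    using fset_functor_lift lift_functor_ext[OF assms(6)] underlying_lift_functor[OF assms(6)] by blast
qed

section \<open>The enriched category of a category with finite powers\<close>

lemma (in category) is_power_1: "X \<in> obj C \<Longrightarrow> is_power C 1 X X (\<lambda>_. idt C X)"
  by (auto simp: is_power_def idt_in cmp_idt_left)

text \<open>The first power of X is chosen to be X itself, and the tuple of a single arrow to be that arrow,
  so that the underlying category of the enriched category constructed here is C on the nose.\<close>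

definition pow :: "('o, 'a) cat \<Rightarrow> nat \<Rightarrow> 'o \<Rightarrow> 'o" where
  "pow C n X = (if n = 1 then X else SOME P. \<exists>p. is_power C n X P p)"

definition pow_proj :: "('o, 'a) cat \<Rightarrow> nat \<Rightarrow> 'o \<Rightarrow> nat \<Rightarrow> 'a" where
  "pow_proj C n X = (if n = 1 then (\<lambda>_. idt C X) else SOME p. is_power C n X (pow C n X) p)"

definition tuple :: "('o, 'a) cat \<Rightarrow> nat \<Rightarrow> 'o \<Rightarrow> 'o \<Rightarrow> (nat \<Rightarrow> 'a) \<Rightarrow> 'a" where
  "tuple C n W X fs = (if n = 1 then fs 0 else
     THE h. h \<in> hom C W (pow C n X) \<and> (\<forall>i<n. cmp C W (pow C n X) X (pow_proj C n X i) h = fs i))"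

text \<open>A map \<open>\<phi> : n \<rightarrow> m\<close> acts contravariantly on powers, as the
  arrow from the m-th to the n-th power whose i-th component is projection \<open>\<phi> i\<close>;
  precomposition with it makes \<open>ehom\<close> covariant in n.\<close>

definition power_fset_cat :: "('o, 'a) cat \<Rightarrow> ('o, 'a) fset_cat" where
  "power_fset_cat C =
     \<lparr>eobj = obj C,
      ehom = (\<lambda>n X Y. hom C (pow C n X) Y),
      push = (\<lambda>n m X Y \<phi> f. cmp C (pow C m X) (pow C n X) Y f
        (tuple C n (pow C m X) X (\<lambda>i. pow_proj C m X (\<phi> i)))),
      eid = idt C,
      ecomp = (\<lambda>m n X Y Z g fs. cmp C (pow C n X) (pow C m Y) Z g (tuple C m (pow C n X) Y fs))\<rparr>"

lemma underlying_power_fset_cat: "underlying_cat (power_fset_cat C) = (C :: ('o, 'a) cat)"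
  by (simp add: underlying_cat_def power_fset_cat_def pow_def tuple_def)

locale fp_category = category +
  assumes finite_powers: "has_finite_powers C"
begin

lemma is_power_pow:
  assumes "X \<in> obj C"
  shows "is_power C n X (pow C n X) (pow_proj C n X)"
proof (cases "n = 1")
  case True
  then show ?thesis using is_power_1[OF assms] by (simp add: pow_def pow_proj_def)
next
  case False
  have "\<exists>p. is_power C n X (pow C n X) p"
    using finite_powers assms False someI_ex[of "\<lambda>P. \<exists>p. is_power C n X P p"]
    by (simp add: pow_def has_finite_powers_def)
  then show ?thesis using False someI_ex[of "is_power C n X (pow C n X)"] by (simp add: pow_proj_def)
qed

lemma pow_in [simp]: "X \<in> obj C \<Longrightarrow> pow C n X \<in> obj C"
  using is_power_pow by (simp add: is_power_def)

lemma pow_proj_in [simp]: "\<lbrakk>X \<in> obj C; i < n\<rbrakk> \<Longrightarrow> pow_proj C n X i \<in> hom C (pow C n X) X"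
  using is_power_pow by (simp add: is_power_def)

lemma tuple_universal:
  assumes "X \<in> obj C" "W \<in> obj C" "\<And>i. i < n \<Longrightarrow> fs i \<in> hom C W X"
  shows "\<exists>!h. h \<in> hom C W (pow C n X) \<and>
    (\<forall>i<n. cmp C W (pow C n X) X (pow_proj C n X i) h = fs i)"
  using is_power_pow[OF assms(1), of n] assms(2,3) by (simp add: is_power_def)

lemma tuple_props:
  assumes "X \<in> obj C" "W \<in> obj C" "\<And>i. i < n \<Longrightarrow> fs i \<in> hom C W X"
  shows "tuple C n W X fs \<in> hom C W (pow C n X) \<and>
    (\<forall>i<n. cmp C W (pow C n X) X (pow_proj C n X i) (tuple C n W X fs) = fs i)"
proof (cases "n = 1")
  case True
  then show ?thesis using assms by (simp add: tuple_def pow_def pow_proj_def cmp_idt_left)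
next
  case False
  then show ?thesis using theI'[OF tuple_universal[OF assms]] by (simp add: tuple_def)
qed

lemma tuple_in [simp]:
  "\<lbrakk>X \<in> obj C; W \<in> obj C; \<And>i. i < n \<Longrightarrow> fs i \<in> hom C W X\<rbrakk>
    \<Longrightarrow> tuple C n W X fs \<in> hom C W (pow C n X)"
  using tuple_props by blast

lemma proj_tuple [simp]:
  "\<lbrakk>X \<in> obj C; W \<in> obj C; \<And>i. i < n \<Longrightarrow> fs i \<in> hom C W X; i < n\<rbrakk>
    \<Longrightarrow> cmp C W (pow C n X) X (pow_proj C n X i) (tuple C n W X fs) = fs i"
  using tuple_props by blast

lemma tuple_eqI:
  assumes "X \<in> obj C" "W \<in> obj C" "h \<in> hom C W (pow C n X)"
    and eq: "\<And>i. i < n \<Longrightarrow> fs i = cmp C W (pow C n X) X (pow_proj C n X i) h"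
  shows "tuple C n W X fs = h"
proof -
  have "fs i \<in> hom C W X" if "i < n" for i
    using that assms by (simp add: cmp_in)
  then show ?thesis
    using tuple_universal[of X W n fs] tuple_props[of X W n fs] assms by metis
qed

lemma tuple_pow_proj:
  "\<lbrakk>X \<in> obj C; \<And>i. i < n \<Longrightarrow> fs i = pow_proj C n X i\<rbrakk>
    \<Longrightarrow> tuple C n (pow C n X) X fs = idt C (pow C n X)"
  by (rule tuple_eqI) (simp_all add: idt_in cmp_idt_right)

text \<open>Together with associativity in C, this naturality of tupling yields the enriched laws
  for iterated pushes, both naturality laws and associativity.\<close>

lemma tuple_cmp:
  assumes "X \<in> obj C" "V \<in> obj C" "W \<in> obj C" "h \<in> hom C V W"
    and "\<And>i. i < n \<Longrightarrow> fs i \<in> hom C W X"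
    and "\<And>i. i < n \<Longrightarrow> gs i = cmp C V W X (fs i) h"
  shows "tuple C n V X gs = cmp C V W (pow C n X) (tuple C n W X fs) h"
  using assms by (intro tuple_eqI) (simp_all add: cmp_in cmp_assoc)

lemma eproj_power_fset_cat:
  "\<lbrakk>X \<in> obj C; i < n\<rbrakk> \<Longrightarrow> eproj (power_fset_cat C) n X i = pow_proj C n X i"
  by (simp add: eproj_def power_fset_cat_def tuple_def pow_def[of _ 1] cmp_idt_left)

lemma fset_category_power_fset_cat: "fset_category (power_fset_cat C)"
proof
  let ?M = "power_fset_cat C"
  show "push ?M n m X Y \<phi> f \<in> ehom ?M m X Y"
    if "X \<in> eobj ?M" "Y \<in> eobj ?M" "\<phi> \<in> Fmap n m" "f \<in> ehom ?M n X Y" for X Y \<phi> n m f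
  proof -
    have "\<phi> i < m" if "i < n" for i using \<open>\<phi> \<in> Fmap n m\<close> that by auto
    with that show ?thesis
      by (simp add: power_fset_cat_def cmp_in)
  qed
  show "push ?M n n X Y (\<lambda>i\<in>{..<n}. i) f = f"
    if "X \<in> eobj ?M" "Y \<in> eobj ?M" "f \<in> ehom ?M n X Y" for X Y n f
    using that by (simp add: power_fset_cat_def tuple_pow_proj cmp_idt_right)
  show "push ?M n k X Y (compose {..<n} \<psi> \<phi>) f = push ?M m k X Y \<psi> (push ?M n m X Y \<phi> f)"
    if "X \<in> eobj ?M" "Y \<in> eobj ?M" "\<phi> \<in> Fmap n m" "\<psi> \<in> Fmap m k" "f \<in> ehom ?M n X Y"
    for X Y \<phi> n m \<psi> k f
  proof -
    have "\<phi> i < m" if "i < n" for i using \<open>\<phi> \<in> Fmap n m\<close> that by auto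
    moreover have "\<psi> i < k" if "i < m" for i using \<open>\<psi> \<in> Fmap m k\<close> that by auto
    moreover have "X \<in> obj C" "Y \<in> obj C" "f \<in> hom C (pow C n X) Y"
      using that by (simp_all add: power_fset_cat_def)
    moreover from calculation
    have "tuple C n (pow C k X) X (\<lambda>i. pow_proj C k X (compose {..<n} \<psi> \<phi> i))
        = cmp C (pow C k X) (pow C m X) (pow C n X)
          (tuple C n (pow C m X) X (\<lambda>i. pow_proj C m X (\<phi> i)))
          (tuple C m (pow C k X) X (\<lambda>i. pow_proj C k X (\<psi> i)))"
      by (intro tuple_cmp) (simp_all add: compose_def)
    ultimately show ?thesis by (simp add: power_fset_cat_def cmp_assoc)
  qed
  show "eid ?M X \<in> ehom ?M 1 X X" if "X \<in> eobj ?M" for X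
    using that by (simp add: power_fset_cat_def pow_def idt_in)
  show "ecomp ?M m n X Y Z g fs \<in> ehom ?M n X Z"
    if "X \<in> eobj ?M" "Y \<in> eobj ?M" "Z \<in> eobj ?M" "g \<in> ehom ?M m Y Z"
      "fs \<in> {..<m} \<rightarrow>\<^sub>E ehom ?M n X Y" for X Y Z g m fs n
  proof -
    have "fs i \<in> hom C (pow C n X) Y" if "i < m" for i
      using \<open>fs \<in> _\<close> that by (auto simp: power_fset_cat_def)
    with that show ?thesis by (simp add: power_fset_cat_def cmp_in)
  qed
  show "push ?M n n' X Z \<phi> (ecomp ?M m n X Y Z g fs)
      = ecomp ?M m n' X Y Z g (\<lambda>i\<in>{..<m}. push ?M n n' X Y \<phi> (fs i))"
    if "X \<in> eobj ?M" "Y \<in> eobj ?M" "Z \<in> eobj ?M" "\<phi> \<in> Fmap n n'" "g \<in> ehom ?M m Y Z"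
      "fs \<in> {..<m} \<rightarrow>\<^sub>E ehom ?M n X Y" for X Y Z \<phi> n n' g m fs
  proof -
    have "\<phi> i < n'" if "i < n" for i using \<open>\<phi> \<in> Fmap n n'\<close> that by auto
    moreover have "X \<in> obj C" "Y \<in> obj C" "Z \<in> obj C" "g \<in> hom C (pow C m Y) Z"
      using that by (simp_all add: power_fset_cat_def)
    moreover have "fs i \<in> hom C (pow C n X) Y" if "i < m" for i
      using \<open>fs \<in> _\<close> that by (auto simp: power_fset_cat_def)
    moreover from calculation
    have "tuple C m (pow C n' X) Y (\<lambda>i\<in>{..<m}. cmp C (pow C n' X) (pow C n X) Y (fs i)
          (tuple C n (pow C n' X) X (\<lambda>i. pow_proj C n' X (\<phi> i))))
        = cmp C (pow C n' X) (pow C n X) (pow C m Y) (tuple C m (pow C n X) Y fs)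
          (tuple C n (pow C n' X) X (\<lambda>i. pow_proj C n' X (\<phi> i)))"
      by (intro tuple_cmp) simp_all
    ultimately show ?thesis by (simp add: power_fset_cat_def cmp_assoc)
  qed
  show "ecomp ?M m' n X Y Z (push ?M m m' Y Z \<phi> g) fs
      = ecomp ?M m n X Y Z g (\<lambda>i\<in>{..<m}. fs (\<phi> i))"
    if "X \<in> eobj ?M" "Y \<in> eobj ?M" "Z \<in> eobj ?M" "\<phi> \<in> Fmap m m'" "g \<in> ehom ?M m Y Z"
      "fs \<in> {..<m'} \<rightarrow>\<^sub>E ehom ?M n X Y" for X Y Z \<phi> m m' g fs n
  proof -
    have "\<phi> i < m'" if "i < m" for i using \<open>\<phi> \<in> Fmap m m'\<close> that by auto
    moreover have "X \<in> obj C" "Y \<in> obj C" "Z \<in> obj C" "g \<in> hom C (pow C m Y) Z"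
      using that by (simp_all add: power_fset_cat_def)
    moreover have "fs i \<in> hom C (pow C n X) Y" if "i < m'" for i
      using \<open>fs \<in> _\<close> that by (auto simp: power_fset_cat_def)
    moreover from calculation have "tuple C m (pow C n X) Y (\<lambda>i\<in>{..<m}. fs (\<phi> i))
        = cmp C (pow C n X) (pow C m' Y) (pow C m Y)
          (tuple C m (pow C m' Y) Y (\<lambda>i. pow_proj C m' Y (\<phi> i))) (tuple C m' (pow C n X) Y fs)"
      by (intro tuple_cmp) simp_all
    ultimately show ?thesis by (simp add: power_fset_cat_def cmp_assoc)
  qed
  show "ecomp ?M n k X Y Y (eproj ?M n Y i) fs = fs i"
    if "X \<in> eobj ?M" "Y \<in> eobj ?M" "fs \<in> {..<n} \<rightarrow>\<^sub>E ehom ?M k X Y" "i < n" for X Y fs n k i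
  proof -
    have "X \<in> obj C" "Y \<in> obj C"
      using that by (simp_all add: power_fset_cat_def)
    moreover have "fs i \<in> hom C (pow C k X) Y" if "i < n" for i
      using \<open>fs \<in> _\<close> that by (auto simp: power_fset_cat_def)
    ultimately show ?thesis
      using \<open>i < n\<close> by (simp add: eproj_power_fset_cat) (simp add: power_fset_cat_def)
  qed
  show "ecomp ?M n n X X Y g (\<lambda>i\<in>{..<n}. eproj ?M n X i) = g"
    if "X \<in> eobj ?M" "Y \<in> eobj ?M" "g \<in> ehom ?M n X Y" for X Y g n
  proof -
    have "X \<in> obj C" "Y \<in> obj C" "g \<in> hom C (pow C n X) Y"
      using that by (simp_all add: power_fset_cat_def)
    then show ?thesis
      by (simp add: eproj_power_fset_cat cong: restrict_cong)
        (simp add: power_fset_cat_def tuple_pow_proj cmp_idt_right)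
  qed
  show "ecomp ?M j n W Y Z h (\<lambda>i\<in>{..<j}. ecomp ?M k n W X Y (gs i) fs)
      = ecomp ?M k n W X Z (ecomp ?M j k X Y Z h gs) fs"
    if "W \<in> eobj ?M" "X \<in> eobj ?M" "Y \<in> eobj ?M" "Z \<in> eobj ?M" "h \<in> ehom ?M j Y Z"
      "gs \<in> {..<j} \<rightarrow>\<^sub>E ehom ?M k X Y" "fs \<in> {..<k} \<rightarrow>\<^sub>E ehom ?M n W X"
    for W X Y Z h j gs k fs n
  proof -
    have "W \<in> obj C" "X \<in> obj C" "Y \<in> obj C" "Z \<in> obj C" "h \<in> hom C (pow C j Y) Z"
      using that by (simp_all add: power_fset_cat_def)
    moreover have "gs i \<in> hom C (pow C k X) Y" if "i < j" for i
      using \<open>gs \<in> _\<close> that by (auto simp: power_fset_cat_def)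
    moreover have "fs i \<in> hom C (pow C n W) X" if "i < k" for i
      using \<open>fs \<in> _\<close> that by (auto simp: power_fset_cat_def)
    moreover from calculation have "tuple C j (pow C n W) Y
          (\<lambda>i\<in>{..<j}. cmp C (pow C n W) (pow C k X) Y (gs i) (tuple C k (pow C n W) X fs))
        = cmp C (pow C n W) (pow C k X) (pow C j Y) (tuple C j (pow C k X) Y gs)
          (tuple C k (pow C n W) X fs)"
      by (intro tuple_cmp) simp_all
    ultimately show ?thesis by (simp add: power_fset_cat_def cmp_assoc)
  qed
qed

text \<open>The identity of the n-th power is itself an n-ary element from X to that power and
  serves as the universal element; the projections of C are the unary \<open>p i\<close>. Both
  defining equations then become unit laws of C.\<close>

lemma representable_power_fset_cat: "representable (power_fset_cat C)"
  unfolding fset_category.representable_iff[OF fset_category_power_fset_cat]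
proof (intro ballI allI)
  fix X n assume "X \<in> eobj (power_fset_cat C)"
  then have X: "X \<in> obj C" by (simp add: power_fset_cat_def)
  have pow_1 [simp]: "pow C 1 Y = Y" for Y by (simp add: pow_def)
  have "equational_power (power_fset_cat C) n X (pow C n X) (restrict (pow_proj C n X) {..<n})
      (idt C (pow C n X))"
    using X unfolding equational_power_def
    by (simp add: eproj_power_fset_cat)
      (simp add: power_fset_cat_def idt_in tuple_pow_proj cmp_idt_left tuple_def[of _ 1]
        cmp_idt_right)
  then show "\<exists>P p u. equational_power (power_fset_cat C) n X P p u" by blast
qed

end

section \<open>The underlying-category 2-functor as an instance of the lifting\<close>

lemma comp1_FSet_CAT: "comp1 FSet_CAT_rep L M N G F = comp_fset_functor L G F"
  by (simp add: comp1_def FSet_CAT_rep_def full_sub_two_cat_def FSet_CAT_def)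

lemma comp2_FSet_CAT: "comp2 FSet_CAT_rep L M N G G' F F' \<beta> \<alpha> =
    (\<lambda>X\<in>eobj L.
      ecomp N 1 1 (efobj G (efobj F X)) (efobj G (efobj F' X)) (efobj G' (efobj F' X))
        (\<beta> (efobj F' X)) (single (efarr G 1 (efobj F X) (efobj F' X) (\<alpha> X))))"
  by (simp add: comp2_def FSet_CAT_rep_def full_sub_two_cat_def FSet_CAT_def)

lemma FSet_CAT_rep_simps:
  "M \<in> tobj FSet_CAT_rep \<longleftrightarrow> fset_category M \<and> representable M"
  "thom FSet_CAT_rep = fset_hom"
  "tid FSet_CAT_rep = id_fset_functor"
  by (simp_all add: FSet_CAT_rep_def full_sub_two_cat_def FSet_CAT_def)

lemma obj_fset_hom: "F \<in> obj (fset_hom M N) \<longleftrightarrow> fset_functor M N F \<and> fset_functor_ext M F"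
  by (simp add: fset_hom_def)

lemma has_finite_powers_underlying:
  assumes "fset_category M" "representable M"
  shows "has_finite_powers (underlying_cat M)"
  unfolding has_finite_powers_def
proof (intro ballI allI)
  interpret fset_category M by fact
  fix X n assume "X \<in> obj (underlying_cat M)"
  then have "X \<in> eobj M" by (simp add: underlying_cat_def)
  then obtain P p u where "equational_power M n X P p u"
    using assms(2) representable_iff by blast
  then show "\<exists>P p. is_power (underlying_cat M) n X P p"
    using fset_power.is_power_underlying[OF fset_powerI] by blast
qed

lemma bij_betw_underlying_functor:
  assumes "fset_category M" "representable M" "fset_category N" "representable N"
  shows "bij_betw underlying_functor (obj (fset_hom M N))
    (obj (fp_hom (underlying_cat M) (underlying_cat N)))"
  unfolding bij_betw_def
proof (intro conjI equalityI subsetI)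
  show "inj_on underlying_functor (obj (fset_hom M N))"
    using underlying_functor_inject assms by (intro inj_onI) (auto simp: obj_fset_hom)
  fix K assume "K \<in> underlying_functor ` obj (fset_hom M N)"
  then obtain F where F: "fset_functor M N F" "fset_functor_ext M F" "K = underlying_functor F"
    by (auto simp: obj_fset_hom)
  then interpret fset_functor_between M N F
    using assms by (intro fset_functor_between.intro)
  show "K \<in> obj (fp_hom (underlying_cat M) (underlying_cat N))"
    using F assms by (simp add: obj_fp_hom is_functor_underlying functor_ext_underlying
        preserves_finite_powers_underlying)
next
  fix K assume "K \<in> obj (fp_hom (underlying_cat M) (underlying_cat N))"
  then show "K \<in> underlying_functor ` obj (fset_hom M N)"
    using underlying_functor_surj[of M N K] assms by (auto simp: obj_fp_hom obj_fset_hom image_iff)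
qed

theorem proposition3p8:
  "two_equivalence
     (FSet_CAT_rep :: (('o, 'a) fset_cat, ('o, 'a, 'o, 'a) fset_fun, 'o \<Rightarrow> 'a) two_cat)
     (CAT_fp :: (('o, 'a) cat, ('o, 'a, 'o, 'a) cat_fun, 'o \<Rightarrow> 'a) two_cat)
     underlying"
proof (rule two_cat_lifting.two_equivalence_lifting, rule two_cat_lifting.intro,
    unfold FSet_CAT_rep_simps thom_CAT_fp tid_CAT_fp comp1_FSet_CAT comp2_FSet_CAT
      comp1_CAT_fp comp2_CAT_fp)
  show "two_category (CAT_fp :: (('o, 'a) cat, ('o, 'a, 'o, 'a) cat_fun, 'o \<Rightarrow> 'a) two_cat)"
    by (rule two_category_CAT_fp)
next
  fix M :: "('o, 'a) fset_cat" assume M: "fset_category M \<and> representable M"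
  then show "map0 underlying M \<in> tobj CAT_fp"
    by (simp add: underlying_def CAT_fp_def fset_category.category_underlying
        has_finite_powers_underlying)
  show "id_fset_functor M \<in> obj (fset_hom M M)"
    using M by (simp add: obj_fset_hom fset_functor_id fset_functor_ext_id)
  show "fobj (maph underlying M M) (id_fset_functor M) = id_functor (map0 underlying M)"
    by (simp add: underlying_def underlying_functor_id)
next
  fix C :: "('o, 'a) cat" assume "C \<in> tobj CAT_fp"
  then interpret fp_category C
    by (auto simp: CAT_fp_def intro: fp_category.intro fp_category_axioms.intro)
  show "\<exists>M\<in>tobj FSet_CAT_rep. map0 underlying M = C"
    using fset_category_power_fset_cat representable_power_fset_cat
    by (intro bexI[of _ "power_fset_cat C"])
      (simp_all add: underlying_def underlying_power_fset_cat FSet_CAT_rep_simps)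
next
  fix M N :: "('o, 'a) fset_cat"
  assume M: "fset_category M \<and> representable M" and N: "fset_category N \<and> representable N"
  then show "bij_betw (fobj (maph underlying M N)) (obj (fset_hom M N))
      (obj (fp_hom (map0 underlying M) (map0 underlying N)))"
    by (simp add: underlying_def bij_betw_underlying_functor)
  \<comment> \<open>Extensionality refers to the same set of objects on both sides, and
    \<open>fset_trans_iff\<close> equates the two notions of naturality.\<close>
  fix F G assume "F \<in> obj (fset_hom M N)" "G \<in> obj (fset_hom M N)"
  with M N show "hom (fset_hom M N) F G
      = hom (fp_hom (map0 underlying M) (map0 underlying N))
          (fobj (maph underlying M N) F) (fobj (maph underlying M N) G)"
    by (auto simp: underlying_def fset_hom_def fp_hom_def fset_trans_iff)
      (simp_all add: underlying_cat_def)
next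
  fix L M N :: "('o, 'a) fset_cat" and G F
  assume "fset_category L \<and> representable L" "G \<in> obj (fset_hom M N)" "F \<in> obj (fset_hom L M)"
  then show "comp_fset_functor L G F \<in> obj (fset_hom L N)"
    by (auto simp: obj_fset_hom fset_functor_ext_comp intro: fset_functor_comp)
next
  fix L M N :: "('o, 'a) fset_cat" and G F
  show "fobj (maph underlying L N) (comp_fset_functor L G F)
      = comp_functor (map0 underlying L) (fobj (maph underlying M N) G)
          (fobj (maph underlying L M) F)"
    by (simp add: underlying_def underlying_functor_comp)
\<comment> \<open>Identities and vertical and horizontal composites coincide by definition, since
  composition in the underlying category is unary enriched composition.\<close>
qed (simp_all add: underlying_def fset_hom_def fp_hom_def underlying_cat_def underlying_functor_def)

end
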